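(* Let $S$ be a Polish space and $\mu_0,\mu_0^{(1)},\mu_0^{(2)},\dots$ diffuse probability measures on $S$ with $\mu_0^{(n)}\to\mu_0$ weakly as $n\to\infty$. For $n\ge1$ let $\rho^{(n)}\in(0,1)$ and let $(\mathbf{x}^{(n)}_i)_{i\ge1}$ be conditionally i.i.d. given $\boldsymbol{\mu}^{(n)}$ with law $\boldsymbol{\mu}^{(n)}$, where $\boldsymbol{\mu}^{(n)}$ is a species sampling process with base measure $\mu_0^{(n)}$ and tie probability $\rho^{(n)}$. (i) If $\rho^{(n)}\to0$, then $\boldsymbol{\mu}^{(n)}$ converges weakly in distribution to $\mu_0$, and $(\mathbf{x}^{(n)}_i)_{i\ge1}$ converges in distribution to an i.i.d. sequence $(\mathbf{x}_i)_{i\ge1}$ with $\mathbf{x}_i\sim\mu_0$. (ii) If $\rho^{(n)}\to1$, then $\boldsymbol{\mu}^{(n)}$ converges weakly in distribution to $\delta_{\mathbf{x}}$ with $\mathbf{x}\sim\mu_0$, and $(\mathbf{x}^{(n)}_i)_{i\ge1}$ converges in distribution to the constant sequence $(\mathbf{x},\mathbf{x},\dots)$.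
   Context: A species sampling process on $S$ with base measure $\lambda_0$ (diffuse probability measure) is a random probability measure $\sum_{j\ge1}\mathbf{w}_j\delta_{\boldsymbol{\xi}_j}+(1-\sum_j\mathbf{w}_j)\lambda_0$ with $\mathbf{w}_j\ge0$, $\sum_j\mathbf{w}_j\le1$ a.s., independent of i.i.d. atoms $\boldsymbol{\xi}_j\sim\lambda_0$; its tie probability is $\sum_j\mathbb{E}[\mathbf{w}_j^2]=\mathbb{P}[\mathbf{x}_1=\mathbf{x}_2]$ for $\mathbf{x}_1,\mathbf{x}_2$ conditionally i.i.d. from it. Random probability measures $\boldsymbol{\mu}^{(n)}$ converge weakly in distribution to $\boldsymbol{\mu}$ if $\int f\,d\boldsymbol{\mu}^{(n)}\to\int f\,d\boldsymbol{\mu}$ in distribution for every bounded continuous $f:S\to\mathbb{R}$. Convergence in distribution of sequences is in $S^\infty$ with the product topology. *)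

theory Defs
  imports "HOL-Probability.Probability"
begin

definition diffuse_prob :: "'a::topological_space measure \<Rightarrow> bool" where
  "diffuse_prob M \<longleftrightarrow> prob_space M \<and> sets M = sets borel \<and> (\<forall>y. emeasure M {y} = 0)"

definition weak_conv_meas :: "(nat \<Rightarrow> 'a::topological_space measure) \<Rightarrow> 'a measure \<Rightarrow> bool" where
  "weak_conv_meas Ms M \<longleftrightarrow>
     (\<forall>f :: 'a \<Rightarrow> real. continuous_on UNIV f \<and> bounded (range f) \<longrightarrow>
        (\<lambda>n. \<integral>y. f y \<partial>Ms n) \<longlonglongrightarrow> (\<integral>y. f y \<partial>M))"

definition species_measure ::
  "'a::topological_space measure \<Rightarrow> (nat \<Rightarrow> 'w \<Rightarrow> real) \<Rightarrow> (nat \<Rightarrow> 'w \<Rightarrow> 'a) \<Rightarrow> 'w \<Rightarrow> 'a measure" where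
  "species_measure lam0 w xi \<omega> =
     measure_of UNIV (sets borel)
       (\<lambda>A. (\<Sum>j. ennreal (w j \<omega>) * indicator A (xi j \<omega>))
            + ennreal (1 - (\<Sum>j. w j \<omega>)) * emeasure lam0 A)"

definition species_sampling ::
  "'w measure \<Rightarrow> ('w \<Rightarrow> 'a::topological_space measure) \<Rightarrow> 'a measure \<Rightarrow> real \<Rightarrow> bool" where
  "species_sampling P mu lam0 rho \<longleftrightarrow>
     (\<exists>(w :: nat \<Rightarrow> 'w \<Rightarrow> real) (xi :: nat \<Rightarrow> 'w \<Rightarrow> 'a).
        (\<forall>j. w j \<in> borel_measurable P) \<and>
        (\<forall>j. xi j \<in> measurable P borel) \<and>
        (AE \<omega> in P. (\<forall>j. 0 \<le> w j \<omega>) \<and> summable (\<lambda>j. w j \<omega>) \<and> (\<Sum>j. w j \<omega>) \<le> 1) \<and>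
        prob_space.indep_vars P (\<lambda>_. borel) xi UNIV \<and>
        (\<forall>j. distr P borel (xi j) = lam0) \<and>
        prob_space.indep_set P
          (sigma_sets (space P) {(\<lambda>\<omega> j. w j \<omega>) -` A \<inter> space P | A.
                                   A \<in> sets (PiM UNIV (\<lambda>_. (borel :: real measure)))})
          (sigma_sets (space P) {(\<lambda>\<omega> j. xi j \<omega>) -` A \<inter> space P | A.
                                   A \<in> sets (PiM UNIV (\<lambda>_. (borel :: 'a measure)))}) \<and>
        (\<forall>\<omega>\<in>space P. mu \<omega> = species_measure lam0 w xi \<omega>) \<and>
        rho = (\<Sum>j. \<integral>\<omega>. (w j \<omega>)\<^sup>2 \<partial>P))"

definition rm_sigma :: "'w measure \<Rightarrow> ('w \<Rightarrow> 'a::topological_space measure) \<Rightarrow> 'w set set" where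
  "rm_sigma P mu = sigma_sets (space P)
     {(\<lambda>\<omega>. emeasure (mu \<omega>) B) -` C \<inter> space P | B C. B \<in> sets borel \<and> C \<in> sets borel}"

definition cond_iid ::
  "'w measure \<Rightarrow> ('w \<Rightarrow> 'a::topological_space measure) \<Rightarrow> (nat \<Rightarrow> 'w \<Rightarrow> 'a) \<Rightarrow> bool" where
  "cond_iid P mu x \<longleftrightarrow>
     (\<forall>i. x i \<in> measurable P borel) \<and>
     (\<forall>(k::nat) (A :: nat \<Rightarrow> 'a set) E.
        (\<forall>i<k. A i \<in> sets borel) \<longrightarrow> E \<in> rm_sigma P mu \<longrightarrow>
        measure P (E \<inter> (\<Inter>i<k. x i -` A i \<inter> space P))
          = (\<integral>\<omega>. indicator E \<omega> * (\<Prod>i<k. measure (mu \<omega>) (A i)) \<partial>P))"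

definition rm_weak_conv_distr ::
  "(nat \<Rightarrow> 'w measure) \<Rightarrow> (nat \<Rightarrow> 'w \<Rightarrow> 'a::topological_space measure)
     \<Rightarrow> 'q measure \<Rightarrow> ('q \<Rightarrow> 'a measure) \<Rightarrow> bool" where
  "rm_weak_conv_distr Ps mus Q mu \<longleftrightarrow>
     (\<forall>f :: 'a \<Rightarrow> real. continuous_on UNIV f \<and> bounded (range f) \<longrightarrow>
        weak_conv_meas (\<lambda>n. distr (Ps n) borel (\<lambda>\<omega>. \<integral>y. f y \<partial>mus n \<omega>))
                  (distr Q borel (\<lambda>q. \<integral>y. f y \<partial>mu q)))"

end

theory Submission
  imports Defs
begin

text \<open>
  Write \<open>F\<^sub>f = \<integral>f d\<mu>\<close> and \<open>\<lambda>\<close> for the base measure. Conditionally on the weights the terms of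
  \<open>F\<^sub>f - \<integral>f d\<lambda> = \<Sum>j. w\<^sub>j (f(\<xi>\<^sub>j) - \<integral>f d\<lambda>)\<close> are independent and centred, so for bounded \<open>f\<close> the second
  moment is at most a constant times the tie probability \<open>\<rho>\<close>. If \<open>\<rho>\<close> tends to 0 then \<open>F\<^sub>f\<close> concentrates
  at \<open>\<integral>f d\<lambda>\<close>. In the other regime some weight is at least \<open>T = \<Sum>j. w\<^sub>j\<^sup>2\<close>, so \<open>\<mu>\<close> is within \<open>1 - T\<close> of a
  point mass at a random \<open>z\<close>, and integration nearly commutes with nonlinear maps: \<open>g(F\<^sub>f)\<close> and
  \<open>\<integral>(g \<circ> f) d\<mu>\<close> are both close to \<open>g(f(z))\<close>. Since \<open>E[1 - T] = 1 - \<rho>\<close> and \<open>E F\<^sub>f = \<integral>f d\<lambda>\<close>, expectations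
  can be compared with integrals against \<open>\<lambda>\<close> without controlling the law of \<open>z\<close>.

  For the sequences, conditional independence turns the expectation of a product
  \<open>\<Prod>i<k. h\<^sub>i(x\<^sub>i)\<close> into that of \<open>\<Prod>i<k. F\<^sub>h\<^sub>i\<close>, and such products determine weak convergence on the sequence
  space: no tightness is needed, because non-negative continuous functions are increasing limits of
  uniform limits of linear combinations of them.
\<close>

section \<open>Species sampling measures\<close>

text \<open>\<open>measure_of\<close> takes the displayed values only when they are countably
  additive. The atomic part is the image under \<open>\<lambda>j. xi j \<omega>\<close> of counting
  measure with density \<open>w j \<omega>\<close>, so additivity is inherited from two genuine
  measures. As \<open>ennreal\<close> cuts negative numbers off at 0, this works at every
  \<open>\<omega>\<close>.\<close>

lemma
  fixes w :: "nat \<Rightarrow> 'w \<Rightarrow> real" and xi :: "nat \<Rightarrow> 'w \<Rightarrow> 'a::topological_space"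
  assumes lam: "sets lam = sets borel"
  shows sets_species_measure [simp, measurable_cong]: "sets (species_measure lam w xi \<omega>) = sets borel"
    and space_species_measure [simp]: "space (species_measure lam w xi \<omega>) = UNIV"
    and emeasure_species_measure: "A \<in> sets borel \<Longrightarrow> emeasure (species_measure lam w xi \<omega>) A =
      (\<Sum>j. ennreal (w j \<omega>) * indicator A (xi j \<omega>)) + ennreal (1 - (\<Sum>j. w j \<omega>)) * emeasure lam A"
proof -
  let ?g = "\<lambda>A. (\<Sum>j. ennreal (w j \<omega>) * indicator A (xi j \<omega>)) + ennreal (1 - (\<Sum>j. w j \<omega>)) * emeasure lam A"
  show sets: "sets (species_measure lam w xi \<omega>) = sets borel"
    by (simp add: species_measure_def sets.sigma_sets_eq[of borel, simplified])
  show "space (species_measure lam w xi \<omega>) = UNIV"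
    by (simp add: species_measure_def)
  define N where "N = distr (density (count_space UNIV) (\<lambda>j. ennreal (w j \<omega>))) (borel :: 'a measure) (\<lambda>j. xi j \<omega>)"
  have N: "(\<Sum>j. ennreal (w j \<omega>) * indicator A (xi j \<omega>)) = emeasure N A" if "A \<in> sets borel" for A
    using that unfolding N_def
    by (simp add: emeasure_distr emeasure_density nn_integral_count_space_nat indicator_def)
  assume A: "A \<in> sets borel"
  have "countably_additive (sets borel) ?g"
    unfolding countably_additive_def
  proof (intro allI impI)
    fix F :: "nat \<Rightarrow> 'a set"
    assume F: "range F \<subseteq> sets borel" "disjoint_family F" "\<Union> (range F) \<in> sets borel"
    have *: "(\<Sum>i. emeasure N (F i)) = emeasure N (\<Union>(range F))" "(\<Sum>i. emeasure lam (F i)) = emeasure lam (\<Union>(range F))"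
      using F by (auto intro!: suminf_emeasure simp: N_def lam)
    have "(\<Sum>i. ?g (F i)) = (\<Sum>i. emeasure N (F i) + ennreal (1 - (\<Sum>j. w j \<omega>)) * emeasure lam (F i))"
      using F by (intro suminf_cong) (auto simp: N)
    also have "\<dots> = ?g (\<Union>(range F))"
      using F by (simp add: suminf_add[symmetric] * N)
    finally show "(\<Sum>i. ?g (F i)) = ?g (\<Union>(range F))" .
  qed
  then show "emeasure (species_measure lam w xi \<omega>) A = ?g A"
    using A sets
    by (intro emeasure_measure_of[OF species_measure_def]) (auto simp: positive_def)
qed

text \<open>Monotone class induction starting from the formula on sets. Staying in
  \<open>ennreal\<close> makes the identity valid at every \<open>\<omega>\<close>, including those
  where the weights do not form a subprobability; measurability in \<open>\<omega>\<close> is later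
  read off from it.\<close>

lemma nn_integral_species_measure:
  fixes u :: "'a::topological_space \<Rightarrow> ennreal"
  assumes lam: "sets lam = sets borel" and u: "u \<in> borel_measurable borel"
  shows "(\<integral>\<^sup>+y. u y \<partial>species_measure lam w xi \<omega>) =
    (\<Sum>j. ennreal (w j \<omega>) * u (xi j \<omega>)) + ennreal (1 - (\<Sum>j. w j \<omega>)) * (\<integral>\<^sup>+y. u y \<partial>lam)"
  using u
proof (induction rule: borel_measurable_induct)
  case (cong f g)
  then have "f = g" by auto
  with cong show ?case by simp
next
  case (set A)
  then show ?case using lam by (simp add: emeasure_species_measure)
next
  case (mult u c)
  have [measurable]: "u \<in> borel_measurable lam" "u \<in> borel_measurable (species_measure lam w xi \<omega>)"
    using mult(2) lam by (auto cong: measurable_cong_sets)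
  have "(\<integral>\<^sup>+ y. c * u y \<partial>species_measure lam w xi \<omega>) = c * (\<integral>\<^sup>+ y. u y \<partial>species_measure lam w xi \<omega>)"
    by (simp add: nn_integral_cmult)
  also have "\<dots> = (\<Sum>j. c * (ennreal (w j \<omega>) * u (xi j \<omega>))) + ennreal (1 - (\<Sum>j. w j \<omega>)) * (c * integral\<^sup>N lam u)"
    by (simp add: mult distrib_left ennreal_suminf_cmult mult.left_commute)
  finally show ?case
    by (simp add: nn_integral_cmult mult.left_commute)
next
  case (add u v)
  have [measurable]: "u \<in> borel_measurable lam" "u \<in> borel_measurable (species_measure lam w xi \<omega>)"
    "v \<in> borel_measurable lam" "v \<in> borel_measurable (species_measure lam w xi \<omega>)"
    using add(1,3) lam by (auto cong: measurable_cong_sets)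
  show ?case
    using add.IH by (simp add: nn_integral_add add distrib_left distrib_right suminf_add[symmetric] ac_simps)
next
  case (seq U)
  have [measurable]: "\<And>i. U i \<in> borel_measurable lam" "\<And>i. U i \<in> borel_measurable (species_measure lam w xi \<omega>)"
    using seq(1) lam by (auto cong: measurable_cong_sets)
  have incU: "incseq (\<lambda>i. U i y)" for y
    using seq(3) by (auto simp: incseq_def le_fun_def)
  let ?c = "ennreal (1 - (\<Sum>j. w j \<omega>))"
  have "(\<integral>\<^sup>+ y. (SUP i. U i) y \<partial>species_measure lam w xi \<omega>) = (SUP i. \<integral>\<^sup>+ y. U i y \<partial>species_measure lam w xi \<omega>)"
    unfolding SUP_apply by (rule nn_integral_monotone_convergence_SUP) (use seq in auto)
  also have "\<dots> = (SUP i. (\<Sum>j. ennreal (w j \<omega>) * U i (xi j \<omega>)) + ?c * integral\<^sup>N lam (U i))"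
    by (simp add: seq)
  also have "\<dots> = (SUP i. \<Sum>j. ennreal (w j \<omega>) * U i (xi j \<omega>)) + (SUP i. ?c * integral\<^sup>N lam (U i))"
    using incU seq(3)
    by (intro ennreal_SUP_add)
       (auto simp: incseq_def le_fun_def intro!: suminf_le mult_left_mono nn_integral_mono)
  also have "(SUP i. \<Sum>j. ennreal (w j \<omega>) * U i (xi j \<omega>)) = (\<Sum>j. SUP i. ennreal (w j \<omega>) * U i (xi j \<omega>))"
    using incU by (intro ennreal_suminf_SUP_eq[symmetric]) (auto simp: incseq_def intro!: mult_left_mono)
  also have "\<dots> = (\<Sum>j. ennreal (w j \<omega>) * (SUP i. U i) (xi j \<omega>))"
    by (simp add: SUP_mult_left_ennreal image_image)
  also have "(SUP i. ?c * integral\<^sup>N lam (U i)) = ?c * (SUP i. integral\<^sup>N lam (U i))"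
    by (simp add: SUP_mult_left_ennreal)
  also have "(SUP i. integral\<^sup>N lam (U i)) = integral\<^sup>N lam (SUP i. U i)"
    unfolding SUP_apply
    by (rule nn_integral_monotone_convergence_SUP[symmetric]) (use seq in auto)
  finally show ?case .
qed

text \<open>Adding the bound \<open>B\<close> makes the integrand non-negative, so a Bochner
  integral can be computed by the \<open>ennreal\<close> formula without splitting into positive and
  negative parts.\<close>

lemma bounded_integral_shift:
  assumes "prob_space M" "f \<in> borel_measurable M" "\<And>y. \<bar>f y\<bar> \<le> (B::real)"
  shows "integrable M f" "ennreal (integral\<^sup>L M f + B) = (\<integral>\<^sup>+y. ennreal (f y + B) \<partial>M)"
proof -
  interpret prob_space M by fact
  show f: "integrable M f"
    by (rule integrable_const_bound[of _ B]) (use assms in auto)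
  have "0 \<le> f y + B" for y using assms(3)[of y] by linarith
  then have "(\<integral>\<^sup>+y. ennreal (f y + B) \<partial>M) = ennreal (\<integral>y. f y + B \<partial>M)"
    using f by (intro nn_integral_eq_integral) auto
  also have "(\<integral>y. f y + B \<partial>M) = integral\<^sup>L M f + B"
    using f by (simp add: prob_space)
  finally show "ennreal (integral\<^sup>L M f + B) = (\<integral>\<^sup>+y. ennreal (f y + B) \<partial>M)" ..
qed

section \<open>The random measure: measurability, total mass and integrals\<close>

text \<open>The weights and atoms that \<open>species_sampling\<close> only asserts to exist are
  fixed here. The tie probability is no parameter and appears as the sum of the expected squared
  weights.\<close>

locale species_process = prob_space P
  for P :: "'w measure" +
  fixes mu :: "'w \<Rightarrow> 'a::topological_space measure" and lam :: "'a measure"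
    and w :: "nat \<Rightarrow> 'w \<Rightarrow> real" and xi :: "nat \<Rightarrow> 'w \<Rightarrow> 'a"
  assumes w_meas [measurable]: "w j \<in> borel_measurable P"
    and xi_meas [measurable]: "xi j \<in> measurable P borel"
    and w_AE: "AE \<omega> in P. (\<forall>j. 0 \<le> w j \<omega>) \<and> summable (\<lambda>j. w j \<omega>) \<and> (\<Sum>j. w j \<omega>) \<le> 1"
    and xi_indep: "indep_vars (\<lambda>_. borel) xi UNIV"
    and xi_distr: "distr P borel (xi j) = lam"
    and w_xi_indep: "indep_set
      (sigma_sets (space P) {(\<lambda>\<omega> j. w j \<omega>) -` A \<inter> space P | A. A \<in> sets (PiM UNIV (\<lambda>_. borel))})
      (sigma_sets (space P) {(\<lambda>\<omega> j. xi j \<omega>) -` A \<inter> space P | A. A \<in> sets (PiM UNIV (\<lambda>_. borel))})"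
    and mu_eq: "\<omega> \<in> space P \<Longrightarrow> mu \<omega> = species_measure lam w xi \<omega>"
begin

text \<open>The almost sure event on which \<open>mu \<omega>\<close> is a probability measure;
  pointwise statements are made on it and then integrated.\<close>

definition good :: "'w \<Rightarrow> bool" where
  "good \<omega> \<longleftrightarrow> \<omega> \<in> space P \<and> (\<forall>j. 0 \<le> w j \<omega>) \<and> summable (\<lambda>j. w j \<omega>) \<and> (\<Sum>j. w j \<omega>) \<le> 1"

lemma AE_good: "AE \<omega> in P. good \<omega>"
  using w_AE AE_space by eventually_elim (auto simp: good_def)

lemma sets_lam [measurable_cong, simp]: "sets lam = sets borel"
  using xi_distr[of 0] by (metis sets_distr)

lemma space_lam [simp]: "space lam = UNIV"
  using sets_eq_imp_space_eq[OF sets_lam] by simp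

lemma prob_space_lam: "prob_space lam"
  using prob_space_distr[OF xi_meas[of 0]] xi_distr[of 0] by simp

lemma sets_mu: "\<omega> \<in> space P \<Longrightarrow> sets (mu \<omega>) = sets borel"
  by (simp add: mu_eq)

lemma nn_integral_mu:
  assumes "\<omega> \<in> space P" "u \<in> borel_measurable borel"
  shows "(\<integral>\<^sup>+y. u y \<partial>mu \<omega>) = (\<Sum>j. ennreal (w j \<omega>) * u (xi j \<omega>)) + ennreal (1 - (\<Sum>j. w j \<omega>)) * (\<integral>\<^sup>+y. u y \<partial>lam)"
  using assms by (simp add: mu_eq nn_integral_species_measure)

lemma measurable_nn_integral_mu:
  assumes [measurable]: "u \<in> borel_measurable borel"
  shows "(\<lambda>\<omega>. \<integral>\<^sup>+y. u y \<partial>mu \<omega>) \<in> borel_measurable P"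
proof -
  have "(\<lambda>\<omega>. (\<Sum>j. ennreal (w j \<omega>) * u (xi j \<omega>)) + ennreal (1 - (\<Sum>j. w j \<omega>)) * (\<integral>\<^sup>+y. u y \<partial>lam)) \<in> borel_measurable P"
    by measurable
  then show ?thesis
    by (rule measurable_cong[THEN iffD1, rotated]) (simp add: nn_integral_mu)
qed

lemma measurable_measure_mu:
  assumes "A \<in> sets borel"
  shows "(\<lambda>\<omega>. measure (mu \<omega>) A) \<in> borel_measurable P"
proof -
  have "(\<lambda>\<omega>. enn2real (\<integral>\<^sup>+y. indicator A y \<partial>mu \<omega>)) \<in> borel_measurable P"
    using measurable_nn_integral_mu[of "indicator A"] assms by measurable
  then show ?thesis
    by (rule measurable_cong[THEN iffD1, rotated]) (use assms in \<open>simp add: measure_def sets_mu\<close>)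
qed

text \<open>Outside \<open>good\<close> the measure \<open>mu \<omega>\<close> may be infinite, and the Bochner integral of a non-integrable
  function is 0.\<close>

lemma measurable_integral_mu:
  fixes f :: "'a \<Rightarrow> real"
  assumes [measurable]: "f \<in> borel_measurable borel"
  shows "(\<lambda>\<omega>. \<integral>y. f y \<partial>mu \<omega>) \<in> borel_measurable P"
proof -
  let ?F = "\<lambda>\<omega>. if (\<integral>\<^sup>+y. ennreal (norm (f y)) \<partial>mu \<omega>) < \<infinity>
      then enn2real (\<integral>\<^sup>+y. ennreal (f y) \<partial>mu \<omega>) - enn2real (\<integral>\<^sup>+y. ennreal (- f y) \<partial>mu \<omega>) else 0"
  have [measurable]: "(\<lambda>\<omega>. \<integral>\<^sup>+y. ennreal (norm (f y)) \<partial>mu \<omega>) \<in> borel_measurable P"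
    "(\<lambda>\<omega>. \<integral>\<^sup>+y. ennreal (f y) \<partial>mu \<omega>) \<in> borel_measurable P"
    "(\<lambda>\<omega>. \<integral>\<^sup>+y. ennreal (- f y) \<partial>mu \<omega>) \<in> borel_measurable P"
    by (rule measurable_nn_integral_mu; measurable)+
  have "?F \<in> borel_measurable P" by measurable
  moreover have "(\<integral>y. f y \<partial>mu \<omega>) = ?F \<omega>" if \<omega>: "\<omega> \<in> space P" for \<omega>
  proof -
    have [measurable]: "f \<in> borel_measurable (mu \<omega>)"
      using assms sets_mu[OF \<omega>] by (simp cong: measurable_cong_sets)
    show ?thesis
      by (auto simp: real_lebesgue_integral_def integrable_iff_bounded not_integrable_integral_eq)
  qed
  ultimately show ?thesis
    by (rule measurable_cong[THEN iffD2, rotated])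
qed

lemma prob_space_mu:
  assumes "good \<omega>"
  shows "prob_space (mu \<omega>)"
proof
  interpret lam: prob_space lam by (rule prob_space_lam)
  have \<omega>: "\<omega> \<in> space P" using assms by (simp add: good_def)
  have "emeasure (mu \<omega>) (space (mu \<omega>)) = (\<integral>\<^sup>+y. 1 \<partial>mu \<omega>)" by simp
  also have "\<dots> = (\<Sum>j. ennreal (w j \<omega>)) + ennreal (1 - (\<Sum>j. w j \<omega>))"
    using \<omega> lam.emeasure_space_1 by (subst nn_integral_mu) simp_all
  also have "\<dots> = ennreal (\<Sum>j. w j \<omega>) + ennreal (1 - (\<Sum>j. w j \<omega>))"
    using assms by (subst suminf_ennreal2) (auto simp: good_def)
  also have "\<dots> = 1"
    using assms by (subst ennreal_plus[symmetric]) (auto simp: good_def suminf_nonneg)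
  finally show "emeasure (mu \<omega>) (space (mu \<omega>)) = 1" .
qed

lemma borel_measurable_mu:
  "good \<omega> \<Longrightarrow> f \<in> borel_measurable borel \<Longrightarrow> f \<in> borel_measurable (mu \<omega>)"
  using sets_mu[of \<omega>] by (simp add: good_def cong: measurable_cong_sets)

text \<open>The non-negative formula is applied to \<open>f + B\<close>. The weights and the
  leftover mass add up to 1, so the shift contributes exactly \<open>B\<close> on both sides and
  cancels.\<close>

lemma integral_mu:
  fixes f :: "'a \<Rightarrow> real"
  assumes good: "good \<omega>" and f [measurable]: "f \<in> borel_measurable borel" and B: "\<And>y. \<bar>f y\<bar> \<le> B"
  shows "integrable (mu \<omega>) f" (is ?A)
    and "summable (\<lambda>j. w j \<omega> * f (xi j \<omega>))" (is ?B)
    and "(\<integral>y. f y \<partial>mu \<omega>) = (\<Sum>j. w j \<omega> * f (xi j \<omega>)) + (1 - (\<Sum>j. w j \<omega>)) * (\<integral>y. f y \<partial>lam)" (is ?C)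
proof -
  interpret mu: prob_space "mu \<omega>" by (rule prob_space_mu) fact
  interpret lam: prob_space lam by (rule prob_space_lam)
  have f' [measurable]: "f \<in> borel_measurable (mu \<omega>)" by (rule borel_measurable_mu) fact+
  have f'' [measurable]: "f \<in> borel_measurable lam" by measurable
  note I = bounded_integral_shift[OF mu.prob_space_axioms f' B]
    bounded_integral_shift[OF lam.prob_space_axioms f'' B]
  show ?A by (rule I)
  have w: "\<And>j. 0 \<le> w j \<omega>" "summable (\<lambda>j. w j \<omega>)" "(\<Sum>j. w j \<omega>) \<le> 1" "\<omega> \<in> space P"
    using good by (auto simp: good_def)
  have nn: "0 \<le> f y + B" "f y + B \<le> 2 * B" for y using B[of y] by linarith+
  have nni: "0 \<le> integral\<^sup>L lam f + B" "0 \<le> integral\<^sup>L (mu \<omega>) f + B"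
  proof -
    have fB: "- B \<le> f y" for y using nn(1)[of y] by linarith
    have "- B \<le> integral\<^sup>L lam f" using I(3) fB by (intro lam.integral_ge_const) auto
    moreover have "- B \<le> integral\<^sup>L (mu \<omega>) f" using I(1) fB by (intro mu.integral_ge_const) auto
    ultimately show "0 \<le> integral\<^sup>L lam f + B" "0 \<le> integral\<^sup>L (mu \<omega>) f + B" by linarith+
  qed
  have s: "summable (\<lambda>j. w j \<omega> * (f (xi j \<omega>) + B))"
    using w nn by (intro summable_comparison_test[OF _ summable_mult2[OF w(2), of "2 * B"]]) (auto intro!: exI[of _ 0] mult_left_mono)
  show b: ?B
    using summable_diff[OF s summable_mult2[OF w(2), of B]] by (simp add: algebra_simps)
  have "ennreal (integral\<^sup>L (mu \<omega>) f + B) =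
    (\<Sum>j. ennreal (w j \<omega>) * ennreal (f (xi j \<omega>) + B)) + ennreal (1 - (\<Sum>j. w j \<omega>)) * ennreal (integral\<^sup>L lam f + B)"
    using w by (simp add: I nn_integral_mu)
  also have "(\<Sum>j. ennreal (w j \<omega>) * ennreal (f (xi j \<omega>) + B)) = ennreal (\<Sum>j. w j \<omega> * (f (xi j \<omega>) + B))"
    using w s nn by (subst suminf_ennreal2[symmetric]) (auto simp: ennreal_mult)
  also have "\<dots> + ennreal (1 - (\<Sum>j. w j \<omega>)) * ennreal (integral\<^sup>L lam f + B) =
      ennreal ((\<Sum>j. w j \<omega> * (f (xi j \<omega>) + B)) + (1 - (\<Sum>j. w j \<omega>)) * (integral\<^sup>L lam f + B))"
    using w s nn nni by (subst ennreal_plus) (auto simp: ennreal_mult intro!: suminf_nonneg)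
  finally have "integral\<^sup>L (mu \<omega>) f + B = (\<Sum>j. w j \<omega> * (f (xi j \<omega>) + B)) + (1 - (\<Sum>j. w j \<omega>)) * (integral\<^sup>L lam f + B)"
    using w s nn nni by (subst (asm) ennreal_inj) (auto intro!: suminf_nonneg add_nonneg_nonneg)
  also have "(\<Sum>j. w j \<omega> * (f (xi j \<omega>) + B)) = (\<Sum>j. w j \<omega> * f (xi j \<omega>)) + (\<Sum>j. w j \<omega>) * B"
    using suminf_add[OF b summable_mult2[OF w(2), of B]] suminf_mult2[OF w(2), of B]
    by (simp add: distrib_left)
  finally show ?C by (simp add: algebra_simps)
qed

section \<open>Moments of the weights, the atoms and the random integrals\<close>

lemma good_w:
  assumes "good \<omega>"
  shows "0 \<le> w j \<omega>" "w j \<omega> \<le> 1" "summable (\<lambda>j. w j \<omega>)" "(\<Sum>j. w j \<omega>) \<le> 1" "(\<Sum>j<N. w j \<omega>) \<le> 1"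
    "summable (\<lambda>j. (w j \<omega>)\<^sup>2)" "(w j \<omega>)\<^sup>2 \<le> w j \<omega>"
proof -
  show w: "0 \<le> w j \<omega>" "summable (\<lambda>j. w j \<omega>)" "(\<Sum>j. w j \<omega>) \<le> 1" for j
    using assms by (auto simp: good_def)
  show N: "(\<Sum>j<N. w j \<omega>) \<le> 1" for N
    using sum_le_suminf[OF w(2), of "{..<N}"] w by force
  show w1: "w j \<omega> \<le> 1" for j
    using N[of "Suc j"] sum_nonneg[of "{..<j}" "\<lambda>j. w j \<omega>"] w(1) by auto
  show sq: "(w j \<omega>)\<^sup>2 \<le> w j \<omega>" for j
    using w(1)[of j] w1[of j] by (simp add: power2_eq_square mult_left_le_one_le)
  show "summable (\<lambda>j. (w j \<omega>)\<^sup>2)"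
    by (rule summable_comparison_test[OF _ w(2)]) (auto simp: sq)
qed

text \<open>A function of a sequence generates a smaller sigma-algebra than the sequence, so the
  independence of weights and atoms passes to real-valued functions of them, where expectations of
  products factorize.\<close>

lemma indep_w_xi:
  assumes u [measurable]: "u \<in> borel_measurable (PiM UNIV (\<lambda>_. borel))"
    and v [measurable]: "v \<in> borel_measurable (PiM UNIV (\<lambda>_. borel))"
  shows "indep_var (borel :: real measure) (\<lambda>\<omega>. u (\<lambda>j. w j \<omega>)) borel (\<lambda>\<omega>. v (\<lambda>j. xi j \<omega>))"
proof -
  have sub: "sigma_sets (space P) {(\<lambda>\<omega>. u (X \<omega>)) -` A \<inter> space P | A. A \<in> sets borel} \<subseteq>
      sigma_sets (space P) {X -` A \<inter> space P | A. A \<in> sets (PiM UNIV (\<lambda>_. borel))}"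
    if u: "u \<in> borel_measurable (PiM UNIV (\<lambda>_. borel))"
    for u :: "(nat \<Rightarrow> 'c::topological_space) \<Rightarrow> real" and X :: "'w \<Rightarrow> nat \<Rightarrow> 'c"
  proof (intro sigma_sets_mono subsetI)
    fix S assume "S \<in> {(\<lambda>\<omega>. u (X \<omega>)) -` A \<inter> space P | A. A \<in> sets borel}"
    then obtain A where A: "A \<in> sets borel" and S: "S = (\<lambda>\<omega>. u (X \<omega>)) -` A \<inter> space P" by auto
    have "u -` A \<in> sets (PiM UNIV (\<lambda>_. borel))"
      using measurable_sets[OF u A] by (simp add: space_PiM)
    then show "S \<in> sigma_sets (space P) {X -` A \<inter> space P | A. A \<in> sets (PiM UNIV (\<lambda>_. borel))}"
      by (intro sigma_sets.Basic) (auto simp: S intro!: exI[of _ "u -` A"])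
  qed
  have "indep_set (sigma_sets (space P) {(\<lambda>\<omega>. u (\<lambda>j. w j \<omega>)) -` A \<inter> space P | A. A \<in> sets borel})
     (sigma_sets (space P) {(\<lambda>\<omega>. v (\<lambda>j. xi j \<omega>)) -` A \<inter> space P | A. A \<in> sets borel})"
    using w_xi_indep unfolding indep_set_def
    by (rule indep_sets_mono_sets) (use sub[OF u] sub[OF v] in \<open>auto split: bool.split\<close>)
  then show ?thesis
    unfolding indep_var_eq by (auto intro!: measurable_compose[OF _ u] measurable_compose[OF _ v] measurable_abs_UNIV)
qed

lemma integrable_w: "integrable P (w j)" "integrable P (\<lambda>\<omega>. w j \<omega> * w k \<omega>)"
proof -
  show "integrable P (w j)"
    using AE_good by (intro integrable_const_bound[of _ 1]) (auto elim!: eventually_mono simp: good_w)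
  show "integrable P (\<lambda>\<omega>. w j \<omega> * w k \<omega>)"
    using AE_good by (intro integrable_const_bound[of _ 1])
      (auto elim!: eventually_mono simp: good_w abs_mult intro!: mult_le_one)
qed

text \<open>Identifies the tie probability with the mean of the random sum of squares. Partial sums
  are dominated by 1, because each squared weight is at most the weight.\<close>

lemma sums_expectation_w_squared:
  "(\<lambda>j. \<integral>\<omega>. (w j \<omega>)\<^sup>2 \<partial>P) sums (\<integral>\<omega>. (\<Sum>j. (w j \<omega>)\<^sup>2) \<partial>P)"
proof -
  have "(\<lambda>N. \<integral>\<omega>. (\<Sum>j<N. (w j \<omega>)\<^sup>2) \<partial>P) \<longlonglongrightarrow> (\<integral>\<omega>. (\<Sum>j. (w j \<omega>)\<^sup>2) \<partial>P)"
  proof (rule integral_dominated_convergence[where w="\<lambda>_. 1"])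
    show "AE \<omega> in P. (\<lambda>N. \<Sum>j<N. (w j \<omega>)\<^sup>2) \<longlonglongrightarrow> (\<Sum>j. (w j \<omega>)\<^sup>2)"
      using AE_good by eventually_elim (intro summable_LIMSEQ good_w)
    show "AE \<omega> in P. norm (\<Sum>j<N. (w j \<omega>)\<^sup>2) \<le> 1" for N
      using AE_good
    proof eventually_elim
      case (elim \<omega>)
      have "(\<Sum>j<N. (w j \<omega>)\<^sup>2) \<le> (\<Sum>j<N. w j \<omega>)"
        using elim by (intro sum_mono good_w)
      then show ?case using good_w(5)[OF elim, of N] by (simp add: sum_nonneg)
    qed
  qed auto
  also have "(\<lambda>N. \<integral>\<omega>. (\<Sum>j<N. (w j \<omega>)\<^sup>2) \<partial>P) = (\<lambda>N. \<Sum>j<N. \<integral>\<omega>. (w j \<omega>)\<^sup>2 \<partial>P)"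
    using integrable_w(2) by (simp add: power2_eq_square)
  finally show ?thesis by (simp add: sums_def)
qed

lemma expectation_xi:
  fixes f :: "'a \<Rightarrow> real"
  assumes "f \<in> borel_measurable borel"
  shows "(\<integral>\<omega>. f (xi j \<omega>) \<partial>P) = (\<integral>y. f y \<partial>lam)"
  using integral_distr[OF xi_meas[of j] assms] by (simp add: xi_distr)

lemma integrable_bounded_xi:
  fixes f :: "'a \<Rightarrow> real"
  assumes [measurable]: "f \<in> borel_measurable borel" and B: "\<And>y. \<bar>f y\<bar> \<le> B"
  shows "integrable P (\<lambda>\<omega>. f (xi j \<omega>))" "integrable P (\<lambda>\<omega>. f (xi j \<omega>) * f (xi k \<omega>))"
proof -
  have "\<bar>f y * f z\<bar> \<le> B * B" for y z
    using B[of y] B[of z] by (auto simp: abs_mult intro!: mult_mono)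
  then show "integrable P (\<lambda>\<omega>. f (xi j \<omega>) * f (xi k \<omega>))"
    by (intro integrable_const_bound[of _ "B * B"]) auto
qed (use B in \<open>auto intro!: integrable_const_bound[of _ B]\<close>)

lemma expectation_xi_mult:
  fixes f :: "'a \<Rightarrow> real"
  assumes f [measurable]: "f \<in> borel_measurable borel" and B: "\<And>y. \<bar>f y\<bar> \<le> B" and "j \<noteq> k"
  shows "(\<integral>\<omega>. f (xi j \<omega>) * f (xi k \<omega>) \<partial>P) = (\<integral>y. f y \<partial>lam)\<^sup>2"
proof -
  have "indep_vars (\<lambda>_. borel) (\<lambda>i \<omega>. f (xi i \<omega>)) {j, k}"
    by (rule indep_vars_compose2[OF indep_vars_subset[OF xi_indep]]) auto
  from indep_vars_lebesgue_integral[OF _ this] integrable_bounded_xi(1)[OF f B] \<open>j \<noteq> k\<close> f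
  show ?thesis by (simp add: expectation_xi power2_eq_square)
qed

text \<open>The terms \<open>w\<^sub>j f(\<xi>\<^sub>j)\<close> are orthogonal when \<open>f\<close> is centred, which gives the second moment.\<close>

lemma moments_centred:
  fixes f :: "'a \<Rightarrow> real"
  assumes f [measurable]: "f \<in> borel_measurable borel" and B: "\<And>y. \<bar>f y\<bar> \<le> B"
    and centred: "(\<integral>y. f y \<partial>lam) = 0"
  shows "(\<integral>\<omega>. (\<integral>y. f y \<partial>mu \<omega>) \<partial>P) = 0"
    and "(\<integral>\<omega>. (\<integral>y. f y \<partial>mu \<omega>)\<^sup>2 \<partial>P) \<le> B\<^sup>2 * (\<Sum>j. \<integral>\<omega>. (w j \<omega>)\<^sup>2 \<partial>P)"
proof -
  define S where "S N \<omega> = (\<Sum>j<N. w j \<omega> * f (xi j \<omega>))" for N \<omega>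
  have [measurable]: "S N \<in> borel_measurable P" for N unfolding S_def by measurable
  have [measurable]: "(\<lambda>\<omega>. \<integral>y. f y \<partial>mu \<omega>) \<in> borel_measurable P"
    by (rule measurable_integral_mu) fact
  have "0 \<le> B" using B[of undefined] by linarith
  \<comment> \<open>The component of \<open>mu \<omega>\<close> along \<open>lam\<close> integrates
    a centred \<open>f\<close> to 0, so only the atomic series remains.\<close>
  have lim: "AE \<omega> in P. (\<lambda>N. S N \<omega>) \<longlonglongrightarrow> (\<integral>y. f y \<partial>mu \<omega>)"
    using AE_good
  proof eventually_elim
    case (elim \<omega>)
    show ?case
      unfolding integral_mu(3)[OF elim f B] centred S_def
      using summable_LIMSEQ[OF integral_mu(2)[OF elim f B]] by simp
  qed
  have bound: "AE \<omega> in P. \<bar>S N \<omega>\<bar> \<le> B" for N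
    using AE_good
  proof eventually_elim
    case (elim \<omega>)
    have "\<bar>S N \<omega>\<bar> \<le> (\<Sum>j<N. w j \<omega> * B)"
      unfolding S_def using good_w[OF elim] B
      by (intro order.trans[OF sum_abs] sum_mono) (auto simp: abs_mult intro!: mult_left_mono)
    also have "\<dots> \<le> 1 * B"
      unfolding sum_distrib_right[symmetric] using good_w(5)[OF elim] \<open>0 \<le> B\<close> by (intro mult_right_mono)
    finally show ?case by simp
  qed
  have indep1: "indep_var borel (w j) borel (\<lambda>\<omega>. f (xi j \<omega>))" for j
    using indep_w_xi[of "\<lambda>x. x j" "\<lambda>x. f (x j)"] by simp
  \<comment> \<open>Pairs of weights are independent of pairs of atoms, so a mixed term factorizes
    even though the weights may depend on each other.\<close>
  have indep2: "indep_var borel (\<lambda>\<omega>. w j \<omega> * w k \<omega>) borel (\<lambda>\<omega>. f (xi j \<omega>) * f (xi k \<omega>))" for j k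
    using indep_w_xi[of "\<lambda>x. x j * x k" "\<lambda>x. f (x j) * f (x k)"] by simp
  note int1 = indep_var_integrable[OF indep1 integrable_w(1) integrable_bounded_xi(1)[OF f B]]
  note int2 = indep_var_integrable[OF indep2 integrable_w(2) integrable_bounded_xi(2)[OF f B]]
  note eq1 = indep_var_lebesgue_integral[OF indep1 integrable_w(1) integrable_bounded_xi(1)[OF f B]]
  note eq2 = indep_var_lebesgue_integral[OF indep2 integrable_w(2) integrable_bounded_xi(2)[OF f B]]
  have "(\<integral>\<omega>. S N \<omega> \<partial>P) = 0" for N
    unfolding S_def using int1 by (simp add: eq1 expectation_xi centred)
  moreover have "(\<lambda>N. \<integral>\<omega>. S N \<omega> \<partial>P) \<longlonglongrightarrow> (\<integral>\<omega>. (\<integral>y. f y \<partial>mu \<omega>) \<partial>P)"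
    by (rule integral_dominated_convergence[where w="\<lambda>_. B"]) (use lim bound in auto)
  ultimately show "(\<integral>\<omega>. (\<integral>y. f y \<partial>mu \<omega>) \<partial>P) = 0"
    by (simp add: LIMSEQ_const_iff)
  let ?rho = "\<Sum>j. \<integral>\<omega>. (w j \<omega>)\<^sup>2 \<partial>P"
  have summ: "summable (\<lambda>j. \<integral>\<omega>. (w j \<omega>)\<^sup>2 \<partial>P)"
    using sums_expectation_w_squared by (rule sums_summable)
  have S2: "(\<integral>\<omega>. (S N \<omega>)\<^sup>2 \<partial>P) \<le> B\<^sup>2 * ?rho" for N
  proof -
    have "(S N \<omega>)\<^sup>2 = (\<Sum>j<N. \<Sum>k<N. (w j \<omega> * w k \<omega>) * (f (xi j \<omega>) * f (xi k \<omega>)))" for \<omega>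
      by (simp add: S_def power2_eq_square sum_product ac_simps)
    then have "(\<integral>\<omega>. (S N \<omega>)\<^sup>2 \<partial>P) =
      (\<Sum>j<N. \<Sum>k<N. (\<integral>\<omega>. w j \<omega> * w k \<omega> \<partial>P) * (\<integral>\<omega>. f (xi j \<omega>) * f (xi k \<omega>) \<partial>P))"
      using int2 by (simp add: eq2)
    also have "\<dots> = (\<Sum>j<N. \<Sum>k<N. if k = j then (\<integral>\<omega>. (w j \<omega>)\<^sup>2 \<partial>P) * (\<integral>y. (f y)\<^sup>2 \<partial>lam) else 0)"
      using expectation_xi[of "\<lambda>y. (f y)\<^sup>2"]
      by (intro sum.cong refl) (auto simp: expectation_xi_mult[OF f B] centred power2_eq_square)
    also have "\<dots> = (\<Sum>j<N. (\<integral>\<omega>. (w j \<omega>)\<^sup>2 \<partial>P)) * (\<integral>y. (f y)\<^sup>2 \<partial>lam)"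
      by (simp add: sum_distrib_right)
    also have "\<dots> \<le> ?rho * B\<^sup>2"
    proof (rule mult_mono)
      show "(\<Sum>j<N. (\<integral>\<omega>. (w j \<omega>)\<^sup>2 \<partial>P)) \<le> ?rho"
        by (rule sum_le_suminf[OF summ]) auto
      interpret lam: prob_space lam by (rule prob_space_lam)
      have sq: "(f y)\<^sup>2 \<le> B\<^sup>2" for y
        using B[of y] \<open>0 \<le> B\<close> by (metis abs_le_square_iff abs_of_nonneg)
      then have "integrable lam (\<lambda>y. (f y)\<^sup>2)"
        by (intro lam.integrable_const_bound[of _ "B\<^sup>2"]) auto
      then show "(\<integral>y. (f y)\<^sup>2 \<partial>lam) \<le> B\<^sup>2"
        using sq by (intro lam.integral_le_const) auto
      show "0 \<le> ?rho" using summ by (intro suminf_nonneg) auto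
    qed simp
    finally show ?thesis by (simp add: mult.commute)
  qed
  have "(\<lambda>N. \<integral>\<omega>. (S N \<omega>)\<^sup>2 \<partial>P) \<longlonglongrightarrow> (\<integral>\<omega>. (\<integral>y. f y \<partial>mu \<omega>)\<^sup>2 \<partial>P)"
  proof (rule integral_dominated_convergence[where w="\<lambda>_. B\<^sup>2"])
    show "AE \<omega> in P. (\<lambda>N. (S N \<omega>)\<^sup>2) \<longlonglongrightarrow> (\<integral>y. f y \<partial>mu \<omega>)\<^sup>2"
      using lim by eventually_elim (rule tendsto_power)
    show "AE \<omega> in P. norm ((S N \<omega>)\<^sup>2) \<le> B\<^sup>2" for N
      using bound[of N] by eventually_elim (use \<open>0 \<le> B\<close> in \<open>simp add: abs_le_square_iff[symmetric]\<close>)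
  qed auto
  then show "(\<integral>\<omega>. (\<integral>y. f y \<partial>mu \<omega>)\<^sup>2 \<partial>P) \<le> B\<^sup>2 * ?rho"
    by (rule LIMSEQ_le_const2) (use S2 in auto)
qed

lemma integral_mu_bound:
  fixes f :: "'a \<Rightarrow> real"
  assumes "good \<omega>" and f: "f \<in> borel_measurable borel" and B: "\<And>y. \<bar>f y\<bar> \<le> B"
  shows "\<bar>\<integral>y. f y \<partial>mu \<omega>\<bar> \<le> B"
proof -
  interpret mu: prob_space "mu \<omega>" by (rule prob_space_mu) fact
  have "\<bar>\<integral>y. f y \<partial>mu \<omega>\<bar> \<le> (\<integral>y. \<bar>f y\<bar> \<partial>mu \<omega>)" by simp
  also have "\<dots> \<le> B"
    using integral_mu(1)[OF assms] B by (intro mu.integral_le_const) auto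
  finally show ?thesis .
qed

lemma integrable_bounded_mu:
  fixes f :: "'a \<Rightarrow> real"
  assumes f: "f \<in> borel_measurable borel" and B: "\<And>y. \<bar>f y\<bar> \<le> B"
  shows "integrable P (\<lambda>\<omega>. \<integral>y. f y \<partial>mu \<omega>)"
  using AE_good measurable_integral_mu[OF f]
  by (intro integrable_const_bound[of _ B]) (auto elim!: eventually_mono intro!: integral_mu_bound f B)

text \<open>Both follow from the centred case applied to \<open>f - c\<close> with \<open>c\<close>
  the integral of \<open>f\<close> against \<open>lam\<close>; since
  \<open>\<bar>c\<bar> \<le> B\<close>, the centred function is bounded by \<open>2 * B\<close>. The
  first moment of the deviation is then controlled by the second.\<close>

lemma
  fixes f :: "'a \<Rightarrow> real"
  assumes f [measurable]: "f \<in> borel_measurable borel" and B: "\<And>y. \<bar>f y\<bar> \<le> B"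
  shows expectation_integral_mu: "(\<integral>\<omega>. (\<integral>y. f y \<partial>mu \<omega>) \<partial>P) = (\<integral>y. f y \<partial>lam)"
    and expectation_deviation_mu: "(\<integral>\<omega>. \<bar>(\<integral>y. f y \<partial>mu \<omega>) - (\<integral>y. f y \<partial>lam)\<bar> \<partial>P) \<le>
      2 * B * sqrt (\<Sum>j. \<integral>\<omega>. (w j \<omega>)\<^sup>2 \<partial>P)"
proof -
  interpret lam: prob_space lam by (rule prob_space_lam)
  define c where "c = (\<integral>y. f y \<partial>lam)"
  have f': "integrable lam f"
    by (rule lam.integrable_const_bound[of _ B]) (use B in auto)
  have "\<bar>c\<bar> \<le> (\<integral>y. \<bar>f y\<bar> \<partial>lam)" unfolding c_def by simp
  also have "\<dots> \<le> B" using f' B by (intro lam.integral_le_const) auto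
  finally have c: "\<bar>c\<bar> \<le> B" .
  have "0 \<le> B" using c by linarith
  let ?g = "\<lambda>y. f y - c" and ?rho = "\<Sum>j. \<integral>\<omega>. (w j \<omega>)\<^sup>2 \<partial>P"
  have g: "?g \<in> borel_measurable borel" by measurable
  have gB: "\<bar>?g y\<bar> \<le> 2 * B" for y using c B[of y] by linarith
  have "(\<integral>y. ?g y \<partial>lam) = 0"
    using f' lam.prob_space by (simp add: c_def)
  note M = moments_centred[OF g gB this]
  have G: "AE \<omega> in P. (\<integral>y. ?g y \<partial>mu \<omega>) = (\<integral>y. f y \<partial>mu \<omega>) - c"
    using AE_good
  proof eventually_elim
    case (elim \<omega>)
    then interpret mu: prob_space "mu \<omega>" by (rule prob_space_mu)
    show ?case using integral_mu(1)[OF elim f B] by (simp add: mu.prob_space)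
  qed
  have [measurable]: "(\<lambda>\<omega>. \<integral>y. f y \<partial>mu \<omega>) \<in> borel_measurable P"
     "(\<lambda>\<omega>. \<integral>y. ?g y \<partial>mu \<omega>) \<in> borel_measurable P"
    by (rule measurable_integral_mu; measurable)+
  have F: "integrable P (\<lambda>\<omega>. \<integral>y. f y \<partial>mu \<omega>)" by (rule integrable_bounded_mu[OF f B])
  have "(\<integral>\<omega>. (\<integral>y. ?g y \<partial>mu \<omega>) \<partial>P) = (\<integral>\<omega>. (\<integral>y. f y \<partial>mu \<omega>) - c \<partial>P)"
    by (rule integral_cong_AE) (use G in auto)
  then show "(\<integral>\<omega>. (\<integral>y. f y \<partial>mu \<omega>) \<partial>P) = (\<integral>y. f y \<partial>lam)"
    using M(1) F by (simp add: prob_space c_def)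
  let ?G = "\<lambda>\<omega>. \<integral>y. ?g y \<partial>mu \<omega>"
  have G1: "integrable P ?G" by (rule integrable_bounded_mu[OF g gB])
  have G2: "integrable P (\<lambda>\<omega>. (?G \<omega>)\<^sup>2)"
  proof (rule integrable_const_bound[of _ "(2 * B)\<^sup>2"])
    show "AE \<omega> in P. norm ((?G \<omega>)\<^sup>2) \<le> (2 * B)\<^sup>2"
      using AE_good
    proof eventually_elim
      case (elim \<omega>)
      have "\<bar>?G \<omega>\<bar> \<le> 2 * B" by (rule integral_mu_bound[OF elim g gB])
      then have "\<bar>?G \<omega>\<bar>\<^sup>2 \<le> (2 * B)\<^sup>2" by (rule power_mono) simp
      then show ?case by simp
    qed
  qed measurable
  \<comment> \<open>Cauchy-Schwarz, in the form that the variance of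
    \<open>\<bar>?G \<omega>\<bar>\<close> is non-negative.\<close>
  have "(\<integral>\<omega>. \<bar>?G \<omega>\<bar> \<partial>P)\<^sup>2 \<le> (\<integral>\<omega>. \<bar>?G \<omega>\<bar>\<^sup>2 \<partial>P)"
    using variance_positive[of "\<lambda>\<omega>. \<bar>?G \<omega>\<bar>"] variance_eq[of "\<lambda>\<omega>. \<bar>?G \<omega>\<bar>"] G1 G2 by simp
  also have "\<dots> \<le> (2 * B)\<^sup>2 * ?rho" using M(2) by simp
  finally have "(\<integral>\<omega>. \<bar>?G \<omega>\<bar> \<partial>P) \<le> sqrt ((2 * B)\<^sup>2 * ?rho)"
    by (rule real_le_rsqrt)
  also have "\<dots> = 2 * B * sqrt ?rho"
    using \<open>0 \<le> B\<close> by (simp add: real_sqrt_mult)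
  also have "(\<integral>\<omega>. \<bar>?G \<omega>\<bar> \<partial>P) = (\<integral>\<omega>. \<bar>(\<integral>y. f y \<partial>mu \<omega>) - c\<bar> \<partial>P)"
    by (rule integral_cong_AE) (use G in auto)
  finally show "(\<integral>\<omega>. \<bar>(\<integral>y. f y \<partial>mu \<omega>) - (\<integral>y. f y \<partial>lam)\<bar> \<partial>P) \<le> 2 * B * sqrt ?rho"
    by (simp add: c_def)
qed

section \<open>Concentration at a dominant atom\<close>

text \<open>Some weight dominates \<open>\<Sum>j. w\<^sub>j\<^sup>2\<close>, since \<open>\<Sum>j. w\<^sub>j\<^sup>2 \<le> (sup\<^sub>j w\<^sub>j) (\<Sum>j. w\<^sub>j)\<close>.\<close>

lemma exists_dominant_weight:
  assumes "good \<omega>"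
  shows "\<exists>j. (\<Sum>i. (w i \<omega>)\<^sup>2) \<le> w j \<omega>"
proof (rule ccontr)
  let ?T = "\<Sum>i. (w i \<omega>)\<^sup>2"
  assume "\<not> ?thesis"
  then have less: "w j \<omega> < ?T" for j by (simp add: not_le)
  note w = good_w[OF assms]
  have "0 < ?T" using less[of 0] w(1)[of 0] by linarith
  then obtain j where j: "w j \<omega> \<noteq> 0"
    using suminf_eq_zero_iff[OF w(6)] by force
  have summ: "summable (\<lambda>i. ?T * w i \<omega>)" using w by (intro summable_mult)
  \<comment> \<open>Each term equals \<open>w i \<omega> * (?T - w i \<omega>)\<close>, hence is
    non-negative, and it is positive at the non-zero weight \<open>j\<close>. Summing gives
    \<open>?T < ?T * (\<Sum>i. w i \<omega>) \<le> ?T\<close>, a contradiction.\<close>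
  have "0 < (\<Sum>i. ?T * w i \<omega> - (w i \<omega>)\<^sup>2)"
  proof (rule suminf_pos2)
    show "summable (\<lambda>i. ?T * w i \<omega> - (w i \<omega>)\<^sup>2)" using summ w by (intro summable_diff)
    show "0 \<le> ?T * w i \<omega> - (w i \<omega>)\<^sup>2" for i
      using less[of i] w(1)[of i] by (simp add: power2_eq_square mult_right_mono)
    show "0 < ?T * w j \<omega> - (w j \<omega>)\<^sup>2"
      using less[of j] w(1)[of j] j by (simp add: power2_eq_square)
  qed
  then have "?T < (\<Sum>i. ?T * w i \<omega>)"
    using suminf_diff[OF summ w(6)] by simp
  also have "\<dots> = ?T * (\<Sum>i. w i \<omega>)" using w by (simp add: suminf_mult)
  also have "\<dots> \<le> ?T * 1" using w \<open>0 < ?T\<close> by (intro mult_left_mono) auto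
  finally show False by simp
qed

text \<open>The point is the atom of a dominant weight \<open>w k \<omega>\<close>: the remaining
  mass \<open>1 - w k \<omega>\<close> is at most
  \<open>1 - (\<Sum>j. (w j \<omega>)\<^sup>2)\<close>, and on it \<open>f\<close> differs from its
  value at the atom by at most \<open>2 * B\<close>. One \<open>z\<close> serves all
  \<open>f\<close> and \<open>B\<close>, so several functions can later be compared at the same
  point.\<close>

lemma exists_concentration_point:
  assumes "good \<omega>"
  shows "\<exists>z. \<forall>(f :: 'a \<Rightarrow> real) B. f \<in> borel_measurable borel \<longrightarrow> (\<forall>y. \<bar>f y\<bar> \<le> B) \<longrightarrow>
    \<bar>(\<integral>y. f y \<partial>mu \<omega>) - f z\<bar> \<le> 2 * B * (1 - (\<Sum>j. (w j \<omega>)\<^sup>2))"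
proof -
  obtain k where k: "(\<Sum>j. (w j \<omega>)\<^sup>2) \<le> w k \<omega>" using exists_dominant_weight[OF assms] ..
  interpret mu: prob_space "mu \<omega>" by (rule prob_space_mu) fact
  interpret lam: prob_space lam by (rule prob_space_lam)
  note w = good_w[OF assms]
  show ?thesis
  proof (intro exI[of _ "xi k \<omega>"] allI impI)
    fix f :: "'a \<Rightarrow> real" and B
    assume f [measurable]: "f \<in> borel_measurable borel" and B: "\<forall>y. \<bar>f y\<bar> \<le> B"
    define G where "G y = \<bar>f y - f (xi k \<omega>)\<bar>" for y
    have G [measurable]: "G \<in> borel_measurable borel" unfolding G_def by measurable
    have GB: "\<bar>G y\<bar> \<le> 2 * B" "0 \<le> G y" "G (xi k \<omega>) = 0" for y
      using B[rule_format, of y] B[rule_format, of "xi k \<omega>"] by (auto simp: G_def)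
    have "0 \<le> B" using GB(1)[of undefined] by linarith
    have GL: "(\<integral>y. G y \<partial>lam) \<le> 2 * B"
    proof (rule lam.integral_le_const)
      show "integrable lam G" by (rule lam.integrable_const_bound[of _ "2 * B"]) (use GB in auto)
    qed (use GB in \<open>auto simp: abs_le_iff\<close>)
    have "\<bar>(\<integral>y. f y \<partial>mu \<omega>) - f (xi k \<omega>)\<bar> = \<bar>\<integral>y. f y - f (xi k \<omega>) \<partial>mu \<omega>\<bar>"
      using integral_mu(1)[OF assms f, of B] B by (simp add: mu.prob_space)
    also have "\<dots> \<le> (\<integral>y. G y \<partial>mu \<omega>)"
      unfolding G_def by (rule integral_abs_bound)
    also have "\<dots> = (\<Sum>j. w j \<omega> * G (xi j \<omega>)) + (1 - (\<Sum>j. w j \<omega>)) * (\<integral>y. G y \<partial>lam)"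
      by (rule integral_mu(3)[OF assms G GB(1)])
    \<comment> \<open>The term at \<open>k\<close> is 0 because \<open>G\<close> vanishes at
      \<open>xi k \<omega>\<close>; any other term is at most \<open>2 * B\<close> times its
      weight.\<close>
    also have "(\<Sum>j. w j \<omega> * G (xi j \<omega>)) \<le> (\<Sum>j. 2 * B * (w j \<omega> - (if j = k then w k \<omega> else 0)))"
    proof (rule suminf_le)
      show "w j \<omega> * G (xi j \<omega>) \<le> 2 * B * (w j \<omega> - (if j = k then w k \<omega> else 0))" for j
        using GB(1)[of "xi j \<omega>"] GB(3) w(1)[of j] by (auto simp: mult.commute[of "w j \<omega>"] intro!: mult_right_mono)
      show "summable (\<lambda>j. w j \<omega> * G (xi j \<omega>))" by (rule integral_mu(2)[OF assms G GB(1)])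
      show "summable (\<lambda>j. 2 * B * (w j \<omega> - (if j = k then w k \<omega> else 0)))"
        using w by (intro summable_mult summable_diff) auto
    qed
    also have "(\<Sum>j. 2 * B * (w j \<omega> - (if j = k then w k \<omega> else 0))) = 2 * B * ((\<Sum>j. w j \<omega>) - w k \<omega>)"
      using w suminf_finite[of "{k}" "\<lambda>j. if j = k then w k \<omega> else 0"]
      by (subst suminf_mult) (auto intro!: summable_diff simp: suminf_diff[symmetric])
    also have "(1 - (\<Sum>j. w j \<omega>)) * (\<integral>y. G y \<partial>lam) \<le> (1 - (\<Sum>j. w j \<omega>)) * (2 * B)"
      using w GL by (intro mult_left_mono) auto
    also have "2 * B * ((\<Sum>j. w j \<omega>) - w k \<omega>) + (1 - (\<Sum>j. w j \<omega>)) * (2 * B) = 2 * B * (1 - w k \<omega>)"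
      by (simp add: algebra_simps)
    also have "\<dots> \<le> 2 * B * (1 - (\<Sum>j. (w j \<omega>)\<^sup>2))"
      using k \<open>0 \<le> B\<close> by (intro mult_left_mono) auto
    finally show "\<bar>(\<integral>y. f y \<partial>mu \<omega>) - f (xi k \<omega>)\<bar> \<le> 2 * B * (1 - (\<Sum>j. (w j \<omega>)\<^sup>2))" by simp
  qed
qed

section \<open>Product expectations of a conditionally i.i.d. sequence\<close>

text \<open>This is \<open>cond_iid\<close> for the full event, moved to non-negative integrals so
  that monotone class arguments run without integrability conditions.\<close>

lemma cond_iid_indicator:
  assumes x: "cond_iid P mu x" and A: "\<And>i. i < k \<Longrightarrow> A i \<in> sets borel"
  shows "(\<integral>\<^sup>+\<omega>. (\<Prod>i<k. indicator (A i) (x i \<omega>)) \<partial>P) = (\<integral>\<^sup>+\<omega>. (\<Prod>i<k. emeasure (mu \<omega>) (A i)) \<partial>P)"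
proof -
  have xm [measurable]: "x i \<in> measurable P borel" for i using x by (simp add: cond_iid_def)
  \<comment> \<open>The outer \<open>space P\<close> matters for \<open>k = 0\<close>, where the
    intersection over no indices is \<open>UNIV\<close>.\<close>
  let ?E = "space P \<inter> (\<Inter>i<k. x i -` A i \<inter> space P)"
  have mm [measurable]: "(\<lambda>\<omega>. measure (mu \<omega>) (A i)) \<in> borel_measurable P" if "i < k" for i
    using measurable_measure_mu[OF A[OF that]] .
  have E: "?E \<in> sets P"
    using A by (cases "k = 0") (auto intro!: sets.Int sets.finite_INT measurable_sets[OF xm])
  have "space P \<in> rm_sigma P mu"
    unfolding rm_sigma_def by (rule sigma_sets_top)
  then have eq: "measure P ?E = (\<integral>\<omega>. indicator (space P) \<omega> * (\<Prod>i<k. measure (mu \<omega>) (A i)) \<partial>P)"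
    using x A unfolding cond_iid_def by blast
  have "(\<integral>\<^sup>+\<omega>. (\<Prod>i<k. indicator (A i) (x i \<omega>)) \<partial>P) = (\<integral>\<^sup>+\<omega>. indicator ?E \<omega> \<partial>P)"
  proof (rule nn_integral_cong)
    fix \<omega> assume \<omega>: "\<omega> \<in> space P"
    show "(\<Prod>i<k. indicator (A i) (x i \<omega>)) = (indicator ?E \<omega> :: ennreal)"
    proof (cases "\<forall>i<k. x i \<omega> \<in> A i")
      case True
      then show ?thesis using \<omega> by simp
    next
      case False
      then show ?thesis by (auto simp: indicator_def)
    qed
  qed
  also have "\<dots> = ennreal (measure P ?E)"
    using E by (simp add: emeasure_eq_measure)
  also have "measure P ?E = (\<integral>\<omega>. (\<Prod>i<k. measure (mu \<omega>) (A i)) \<partial>P)"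
    unfolding eq by (rule Bochner_Integration.integral_cong) auto
  also have "ennreal \<dots> = (\<integral>\<^sup>+\<omega>. ennreal (\<Prod>i<k. measure (mu \<omega>) (A i)) \<partial>P)"
  proof (rule nn_integral_eq_integral[symmetric])
    show "integrable P (\<lambda>\<omega>. \<Prod>i<k. measure (mu \<omega>) (A i))"
    proof (rule integrable_const_bound[of _ 1])
      show "AE \<omega> in P. norm (\<Prod>i<k. measure (mu \<omega>) (A i)) \<le> 1"
        using AE_good
      proof eventually_elim
        case (elim \<omega>)
        then interpret mu: prob_space "mu \<omega>" by (rule prob_space_mu)
        show ?case by (auto simp: abs_prod intro!: prod_le_1)
      qed
    qed measurable
  qed (simp add: prod_nonneg)
  also have "\<dots> = (\<integral>\<^sup>+\<omega>. (\<Prod>i<k. emeasure (mu \<omega>) (A i)) \<partial>P)"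
  proof (rule nn_integral_cong_AE)
    show "AE \<omega> in P. ennreal (\<Prod>i<k. measure (mu \<omega>) (A i)) = (\<Prod>i<k. emeasure (mu \<omega>) (A i))"
      using AE_good
    proof eventually_elim
      case (elim \<omega>)
      then interpret mu: prob_space "mu \<omega>" by (rule prob_space_mu)
      show ?case by (simp add: mu.emeasure_eq_measure prod_ennreal)
    qed
  qed
  finally show ?thesis .
qed

text \<open>Indicators are replaced by general functions one coordinate at a time: those below
  \<open>m\<close> are arbitrary, those from \<open>m\<close> on still indicators. Passing from
  \<open>m\<close> to \<open>Suc m\<close> is a second induction, on the function at coordinate
  \<open>m\<close>, with the product over the other coordinates as a fixed factor.\<close>

lemma cond_iid_nn_integral:
  fixes u :: "nat \<Rightarrow> 'a \<Rightarrow> ennreal"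
  assumes x: "cond_iid P mu x" and u: "\<And>i. u i \<in> borel_measurable borel"
    and ind: "\<And>i. m \<le> i \<Longrightarrow> i < k \<Longrightarrow> \<exists>A\<in>sets borel. u i = indicator A"
  shows "(\<integral>\<^sup>+\<omega>. (\<Prod>i<k. u i (x i \<omega>)) \<partial>P) = (\<integral>\<^sup>+\<omega>. (\<Prod>i<k. \<integral>\<^sup>+y. u i y \<partial>mu \<omega>) \<partial>P)"
  using u ind
proof (induction m arbitrary: u)
  case 0
  then obtain A where A: "\<And>i. i < k \<Longrightarrow> A i \<in> sets borel \<and> u i = indicator (A i)"
    by (metis le0)
  have "(\<integral>\<^sup>+\<omega>. (\<Prod>i<k. u i (x i \<omega>)) \<partial>P) = (\<integral>\<^sup>+\<omega>. (\<Prod>i<k. indicator (A i) (x i \<omega>)) \<partial>P)"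
    using A by simp
  also have "\<dots> = (\<integral>\<^sup>+\<omega>. (\<Prod>i<k. emeasure (mu \<omega>) (A i)) \<partial>P)"
    using A by (intro cond_iid_indicator x) auto
  also have "\<dots> = (\<integral>\<^sup>+\<omega>. (\<Prod>i<k. \<integral>\<^sup>+y. u i y \<partial>mu \<omega>) \<partial>P)"
    using A sets_mu by (intro nn_integral_cong prod.cong refl) simp
  finally show ?case .
next
  case (Suc m)
  show ?case
  proof (cases "m < k")
    case False
    then show ?thesis using Suc.prems by (intro Suc.IH) auto
  next
    case True
    have [measurable]: "x i \<in> measurable P borel" for i using x by (simp add: cond_iid_def)
    note [measurable] = Suc.prems(1) and [measurable] = measurable_nn_integral_mu
    let ?R = "\<lambda>\<omega>. \<Prod>i\<in>{..<k}-{m}. u i (x i \<omega>)"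
    let ?S = "\<lambda>\<omega>. \<Prod>i\<in>{..<k}-{m}. \<integral>\<^sup>+y. u i y \<partial>mu \<omega>"
    have [measurable]: "?R \<in> borel_measurable P" "?S \<in> borel_measurable P" by measurable
    have split: "(\<Prod>i<k. F i) = F m * (\<Prod>i\<in>{..<k}-{m}. F i)" for F :: "nat \<Rightarrow> ennreal"
      using True by (subst prod.remove[of _ m]) auto
    have mu_meas: "v \<in> borel_measurable (mu \<omega>)" if "v \<in> borel_measurable borel" "\<omega> \<in> space P" for v :: "'a \<Rightarrow> ennreal" and \<omega>
      using that sets_mu by (simp cong: measurable_cong_sets)
    have "(\<integral>\<^sup>+\<omega>. u m (x m \<omega>) * ?R \<omega> \<partial>P) = (\<integral>\<^sup>+\<omega>. (\<integral>\<^sup>+y. u m y \<partial>mu \<omega>) * ?S \<omega> \<partial>P)"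
      using Suc.prems(1)[of m]
    proof (induction rule: borel_measurable_induct)
      case (cong f g)
      then have "f = g" by auto
      with cong show ?case by simp
    next
      case (set A)
      \<comment> \<open>With an indicator at coordinate \<open>m\<close> the family falls under the
        outer induction hypothesis.\<close>
      let ?u = "u(m := indicator A)"
      have "(\<integral>\<^sup>+\<omega>. (\<Prod>i<k. ?u i (x i \<omega>)) \<partial>P) = (\<integral>\<^sup>+\<omega>. (\<Prod>i<k. \<integral>\<^sup>+y. ?u i y \<partial>mu \<omega>) \<partial>P)"
        using Suc.prems set by (intro Suc.IH) (auto simp: le_Suc_eq Suc_le_eq)
      then show ?case by (simp add: split)
    next
      case (mult v c)
      note [measurable] = mult(2)
      have "(\<integral>\<^sup>+\<omega>. (\<integral>\<^sup>+y. c * v y \<partial>mu \<omega>) * ?S \<omega> \<partial>P) = (\<integral>\<^sup>+\<omega>. c * ((\<integral>\<^sup>+y. v y \<partial>mu \<omega>) * ?S \<omega>) \<partial>P)"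
        by (intro nn_integral_cong) (simp add: nn_integral_cmult mu_meas mult ac_simps)
      then show ?case by (simp add: nn_integral_cmult mult.IH mult.assoc)
    next
      case (add v v')
      note [measurable] = add(1,3)
      have "(\<integral>\<^sup>+\<omega>. (\<integral>\<^sup>+y. v' y + v y \<partial>mu \<omega>) * ?S \<omega> \<partial>P) =
          (\<integral>\<^sup>+\<omega>. (\<integral>\<^sup>+y. v' y \<partial>mu \<omega>) * ?S \<omega> + (\<integral>\<^sup>+y. v y \<partial>mu \<omega>) * ?S \<omega> \<partial>P)"
        by (intro nn_integral_cong) (simp add: nn_integral_add mu_meas add distrib_right)
      then show ?case by (simp add: nn_integral_add add.IH distrib_right)
    next
      case (seq U)
      note [measurable] = seq(1)
      have inc: "incseq (\<lambda>i. U i y)" for y using seq(3) by (auto simp: incseq_def le_fun_def)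
      have "(\<integral>\<^sup>+\<omega>. (SUP i. U i) (x m \<omega>) * ?R \<omega> \<partial>P) = (\<integral>\<^sup>+\<omega>. (SUP i. U i (x m \<omega>) * ?R \<omega>) \<partial>P)"
        by (simp add: SUP_mult_right_ennreal image_image)
      also have "\<dots> = (SUP i. \<integral>\<^sup>+\<omega>. U i (x m \<omega>) * ?R \<omega> \<partial>P)"
        using inc by (intro nn_integral_monotone_convergence_SUP)
          (auto simp: incseq_def le_fun_def intro!: mult_right_mono)
      also have "\<dots> = (SUP i. \<integral>\<^sup>+\<omega>. (\<integral>\<^sup>+y. U i y \<partial>mu \<omega>) * ?S \<omega> \<partial>P)"
        by (simp add: seq)
      also have "\<dots> = (\<integral>\<^sup>+\<omega>. (SUP i. (\<integral>\<^sup>+y. U i y \<partial>mu \<omega>) * ?S \<omega>) \<partial>P)"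
        using inc by (intro nn_integral_monotone_convergence_SUP[symmetric])
          (auto simp: incseq_def le_fun_def intro!: mult_right_mono nn_integral_mono)
      also have "\<dots> = (\<integral>\<^sup>+\<omega>. (\<integral>\<^sup>+y. (SUP i. U i) y \<partial>mu \<omega>) * ?S \<omega> \<partial>P)"
      proof (rule nn_integral_cong)
        fix \<omega> assume \<omega>: "\<omega> \<in> space P"
        have "(\<integral>\<^sup>+y. (SUP i. U i) y \<partial>mu \<omega>) = (SUP i. \<integral>\<^sup>+y. U i y \<partial>mu \<omega>)"
          unfolding SUP_apply
          by (rule nn_integral_monotone_convergence_SUP[OF seq(3) mu_meas[OF seq(1) \<omega>]])
        then show "(SUP i. (\<integral>\<^sup>+y. U i y \<partial>mu \<omega>) * ?S \<omega>) = (\<integral>\<^sup>+y. (SUP i. U i) y \<partial>mu \<omega>) * ?S \<omega>"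
          by (simp add: SUP_mult_right_ennreal)
      qed
      finally show ?case .
    qed
    then show ?thesis by (simp add: split)
  qed
qed

lemma cond_iid_expectation:
  fixes h :: "nat \<Rightarrow> 'a \<Rightarrow> real"
  assumes x: "cond_iid P mu x" and h [measurable]: "\<And>i. h i \<in> borel_measurable borel"
    and h01: "\<And>i y. 0 \<le> h i y \<and> h i y \<le> 1"
  shows "(\<integral>\<omega>. (\<Prod>i<k. h i (x i \<omega>)) \<partial>P) = (\<integral>\<omega>. (\<Prod>i<k. \<integral>y. h i y \<partial>mu \<omega>) \<partial>P)"
proof -
  have [measurable]: "x i \<in> measurable P borel" for i using x by (simp add: cond_iid_def)
  have [measurable]: "(\<lambda>\<omega>. \<integral>y. h i y \<partial>mu \<omega>) \<in> borel_measurable P" for i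
    by (rule measurable_integral_mu) measurable
  have nn: "0 \<le> (\<integral>y. h i y \<partial>mu \<omega>)" for i \<omega>
    using h01 by (intro integral_nonneg_AE) auto
  have "(\<integral>\<omega>. (\<Prod>i<k. h i (x i \<omega>)) \<partial>P) = enn2real (\<integral>\<^sup>+\<omega>. (\<Prod>i<k. ennreal (h i (x i \<omega>))) \<partial>P)"
    using h01 by (subst integral_eq_nn_integral) (auto simp: prod_ennreal intro!: prod_nonneg)
  also have "(\<integral>\<^sup>+\<omega>. (\<Prod>i<k. ennreal (h i (x i \<omega>))) \<partial>P) = (\<integral>\<^sup>+\<omega>. (\<Prod>i<k. \<integral>\<^sup>+y. ennreal (h i y) \<partial>mu \<omega>) \<partial>P)"
    \<comment> \<open>At \<open>m = k\<close> the indicator condition concerns no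
      coordinate.\<close>
    by (rule cond_iid_nn_integral[OF x, where m=k]) auto
  also have "\<dots> = (\<integral>\<^sup>+\<omega>. (\<Prod>i<k. ennreal (\<integral>y. h i y \<partial>mu \<omega>)) \<partial>P)"
  proof (rule nn_integral_cong_AE)
    show "AE \<omega> in P. (\<Prod>i<k. \<integral>\<^sup>+y. ennreal (h i y) \<partial>mu \<omega>) = (\<Prod>i<k. ennreal (\<integral>y. h i y \<partial>mu \<omega>))"
      using AE_good
    proof eventually_elim
      case (elim \<omega>)
      show ?case
        using h01 by (intro prod.cong refl nn_integral_eq_integral integral_mu(1)[OF elim h, of _ 1]) auto
    qed
  qed
  also have "enn2real \<dots> = (\<integral>\<omega>. (\<Prod>i<k. \<integral>y. h i y \<partial>mu \<omega>) \<partial>P)"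
    using nn by (subst integral_eq_nn_integral) (auto simp: prod_ennreal intro!: prod_nonneg)
  finally show ?thesis .
qed

end

section \<open>Weak convergence on the sequence space\<close>

text \<open>The span of products of coordinate functions is an algebra; its uniform closure is therefore
  closed under maxima.\<close>

inductive cyl :: "((nat \<Rightarrow> 'a::topological_space) \<Rightarrow> real) \<Rightarrow> bool" where
  prod: "(\<And>i. continuous_on UNIV (h i)) \<Longrightarrow> (\<And>i y. 0 \<le> h i y \<and> h i y \<le> 1) \<Longrightarrow> cyl (\<lambda>x. c * (\<Prod>i<k. h i (x i)))"
| add: "cyl f \<Longrightarrow> cyl g \<Longrightarrow> cyl (\<lambda>x. f x + g x)"

lemma cyl_const: "cyl (\<lambda>x. c)"
  using cyl.prod[of "\<lambda>_ _. 1" c 0] by simp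

text \<open>Two products of different lengths are padded with the constant function 1 up to the
  larger length. Factors then multiply coordinate by coordinate and keep their values in
  [0, 1].\<close>

lemma cyl_mult:
  assumes "cyl f" "cyl g"
  shows "cyl (\<lambda>x. f x * g x)"
  using assms(1)
proof induction
  case (prod h c k)
  from assms(2) show ?case
  proof induction
    case (prod h' c' k')
    let ?H = "\<lambda>i y. (if i < k then h i y else 1) * (if i < k' then h' i y else 1)"
    have pad: "(\<Prod>i<l. f i (x i)) = (\<Prod>i<max k k'. if i < l then f i (x i) else 1)"
      if "l \<le> max k k'" for l and f :: "nat \<Rightarrow> 'a \<Rightarrow> real" and x
      using that by (intro prod.mono_neutral_cong_left) auto
    have "cyl (\<lambda>x. (c * c') * (\<Prod>i<max k k'. ?H i (x i)))"
    proof (rule cyl.prod)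
      show "continuous_on UNIV (?H i)" for i
        by (cases "i < k"; cases "i < k'") (auto intro!: continuous_intros prod.hyps \<open>\<And>i. continuous_on UNIV (h i)\<close>)
      show "0 \<le> ?H i y \<and> ?H i y \<le> 1" for i y
        using prod.hyps(2)[of i y] \<open>\<And>i y. 0 \<le> h i y \<and> h i y \<le> 1\<close>[of i y] by (auto intro: mult_le_one)
    qed
    also have "(\<lambda>x. (c * c') * (\<Prod>i<max k k'. ?H i (x i))) =
        (\<lambda>x. (c * (\<Prod>i<k. h i (x i))) * (c' * (\<Prod>i<k'. h' i (x i))))"
      by (simp add: pad[of k h] pad[of k' h'] prod.distrib ac_simps)
    finally show ?case .
  next
    case (add f' g')
    then show ?case using cyl.add by (fastforce simp: distrib_left)
  qed
next
  case (add f' g')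
  then show ?case using cyl.add by (fastforce simp: distrib_right)
qed

lemma cyl_polynomial:
  fixes q :: "real \<Rightarrow> real"
  assumes "real_polynomial_function q" "cyl f"
  shows "cyl (\<lambda>x. q (f x))"
  using assms(1)
proof induction
  case (linear q)
  then obtain a where "q = (\<lambda>y. y * a)" using real_bounded_linear by auto
  then show ?case using cyl_mult[OF assms(2) cyl_const[of a]] by simp
qed (auto intro: cyl_const cyl_mult cyl.add)

lemma cyl_continuous_bounded:
  assumes "cyl f"
  shows "continuous_on UNIV f \<and> (\<exists>B. \<forall>x. \<bar>f x\<bar> \<le> B)"
  using assms
proof induction
  case (prod h c k)
  have "continuous_on UNIV (\<lambda>x :: nat \<Rightarrow> 'a. h i (x i))" for i
    using continuous_on_compose2[OF prod(1) continuous_on_product_coordinates] by simp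
  moreover have "\<bar>c * (\<Prod>i<k. h i (x i))\<bar> \<le> \<bar>c\<bar>" for x
    using prod_le_1[of "{..<k}" "\<lambda>i. h i (x i)"] prod_nonneg[of "{..<k}" "\<lambda>i. h i (x i)"] prod(2)
    by (auto simp: abs_mult intro!: mult_left_le)
  ultimately show ?case by (auto intro!: continuous_intros exI[of _ "\<bar>c\<bar>"])
next
  case (add f g)
  then obtain B C where "\<forall>x. \<bar>f x\<bar> \<le> B" "\<forall>x. \<bar>g x\<bar> \<le> C" by auto
  then have "\<bar>f x + g x\<bar> \<le> B + C" for x
    using abs_triangle_ineq[of "f x" "g x"] by (smt (verit))
  with add show ?case by (auto intro!: continuous_intros)
qed

section \<open>The uniform closure of the cylinder functions\<close>

definition cyl_closure :: "((nat \<Rightarrow> 'a::topological_space) \<Rightarrow> real) \<Rightarrow> bool" where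
  "cyl_closure f \<longleftrightarrow> (\<forall>e>0. \<exists>p. cyl p \<and> (\<forall>x. \<bar>f x - p x\<bar> < e))"

lemma cyl_closureI: "cyl f \<Longrightarrow> cyl_closure f"
  by (auto simp: cyl_closure_def)

lemma cyl_closure_add:
  assumes "cyl_closure f" "cyl_closure g"
  shows "cyl_closure (\<lambda>x. f x + g x)"
  unfolding cyl_closure_def
proof (intro allI impI)
  fix e :: real assume "0 < e"
  then obtain p q where p: "cyl p" "cyl q" and d: "\<And>x. \<bar>f x - p x\<bar> < e / 2" "\<And>x. \<bar>g x - q x\<bar> < e / 2"
    using assms unfolding cyl_closure_def by (metis half_gt_zero)
  have "\<bar>(f x + g x) - (p x + q x)\<bar> < e" for x
    using d[of x] by linarith
  then show "\<exists>p. cyl p \<and> (\<forall>x. \<bar>f x + g x - p x\<bar> < e)"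
    using cyl.add[OF p] by (intro exI[of _ "\<lambda>x. p x + q x"]) auto
qed

text \<open>Replace \<open>f\<close> by a cylinder function \<open>p\<close>, at a cost controlled
  by the Lipschitz constant. As \<open>p\<close> is bounded, the Weierstrass theorem on a compact
  interval containing its range replaces \<open>F\<close> by a polynomial \<open>q\<close>, and
  \<open>q (p x)\<close> is again a cylinder function.\<close>

lemma cyl_closure_polynomial_limit:
  fixes F :: "real \<Rightarrow> real"
  assumes F: "continuous_on UNIV F" "\<And>a b. \<bar>F a - F b\<bar> \<le> L * \<bar>a - b\<bar>" and f: "cyl_closure f"
  shows "cyl_closure (\<lambda>x. F (f x))"
  unfolding cyl_closure_def
proof (intro allI impI)
  fix e :: real assume e: "0 < e"
  \<comment> \<open>Chosen so that an error \<open>d\<close> in the argument costs at most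
    \<open>e / 2\<close>; the summand 1 keeps the denominator positive when \<open>L\<close> is
    0.\<close>
  define d where "d = e / (2 * (\<bar>L\<bar> + 1))"
  have d: "0 < d" "\<bar>L\<bar> * d \<le> e / 2"
    using e by (auto simp: d_def field_simps)
  obtain p where p: "cyl p" "\<And>x. \<bar>f x - p x\<bar> < d"
    using f d(1) unfolding cyl_closure_def by metis
  obtain B where B: "\<And>x. \<bar>p x\<bar> \<le> B" using cyl_continuous_bounded[OF p(1)] by auto
  obtain q where q: "real_polynomial_function q" "\<And>y. y \<in> {-B..B} \<Longrightarrow> \<bar>F y - q y\<bar> < e / 2"
    using Stone_Weierstrass_real_polynomial_function[of "{-B..B}" F "e / 2"] e continuous_on_subset[OF F(1)]
    by auto
  have "\<bar>F (f x) - q (p x)\<bar> < e" for x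
  proof -
    have "\<bar>F (f x) - F (p x)\<bar> \<le> \<bar>L\<bar> * d"
      using F(2)[of "f x" "p x"] p(2)[of x] mult_mono'[of "\<bar>L\<bar>" "\<bar>L\<bar>" "\<bar>f x - p x\<bar>" d]
        mult_right_mono[OF abs_ge_self[of L], of "\<bar>f x - p x\<bar>"] by simp
    moreover have "\<bar>F (p x) - q (p x)\<bar> < e / 2" using B[of x] by (intro q) (auto simp: abs_le_iff)
    ultimately show ?thesis using d(2) by linarith
  qed
  then show "\<exists>p. cyl p \<and> (\<forall>x. \<bar>F (f x) - p x\<bar> < e)"
    using cyl_polynomial[OF q(1) p(1)] by auto
qed

text \<open>The maximum of two numbers is half of their sum plus the modulus of their difference;
  the modulus and multiplication by a constant are both Lipschitz.\<close>

lemma cyl_closure_max: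
  assumes "cyl_closure f" "cyl_closure g"
  shows "cyl_closure (\<lambda>x. max (f x) (g x))"
proof -
  have scale: "cyl_closure (\<lambda>x. a * h x)" if "cyl_closure h" for a and h :: "(nat \<Rightarrow> 'a) \<Rightarrow> real"
    by (rule cyl_closure_polynomial_limit[OF _ _ that, of "\<lambda>y. a * y" "\<bar>a\<bar>"])
       (auto intro!: continuous_intros simp: abs_mult[symmetric] right_diff_distrib)
  have "cyl_closure (\<lambda>x. \<bar>f x + (-1) * g x\<bar>)"
    by (intro cyl_closure_polynomial_limit[of abs 1] cyl_closure_add scale assms)
       (auto intro!: continuous_intros)
  then have "cyl_closure (\<lambda>x. (1 / 2) * (f x + g x + \<bar>f x + (-1) * g x\<bar>))"
    by (intro scale cyl_closure_add assms)
  also have "(\<lambda>x. (1 / 2) * (f x + g x + \<bar>f x + (-1) * g x\<bar>)) = (\<lambda>x. max (f x) (g x))"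
    by (auto simp: max_def abs_if)
  finally show ?thesis .
qed

lemma cyl_closure_Max:
  fixes e :: "nat \<Rightarrow> (nat \<Rightarrow> 'a::topological_space) \<Rightarrow> real"
  assumes "\<And>j. cyl (e j)"
  shows "cyl_closure (\<lambda>x. Max ((\<lambda>j. e j x) ` {..m})) \<and> continuous_on UNIV (\<lambda>x. Max ((\<lambda>j. e j x) ` {..m}))"
proof (induction m)
  case 0
  then show ?case using assms[of 0] cyl_continuous_bounded by (auto intro: cyl_closureI)
next
  case (Suc m)
  have eq: "(\<lambda>x. Max ((\<lambda>j. e j x) ` {..Suc m})) = (\<lambda>x. max (e (Suc m) x) (Max ((\<lambda>j. e j x) ` {..m})))"
    by (simp add: atMost_Suc)
  have "cyl_closure (e (Suc m))" "continuous_on UNIV (e (Suc m))"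
    using assms[of "Suc m"] cyl_continuous_bounded by (auto intro: cyl_closureI)
  with Suc show ?case
    unfolding eq by (intro conjI cyl_closure_max continuous_on_max) simp_all
qed

section \<open>Approximation from below by cylinder bumps\<close>

text \<open>Every non-negative continuous function on the sequence space is the supremum of countably many
  scaled cylinder bumps, indexed by the rational \<open>q\<close> and by the list of centres and inverse radii.\<close>

definition bump :: "'a::metric_space \<Rightarrow> nat \<Rightarrow> 'a \<Rightarrow> real" where
  "bump d N y = max 0 (min 1 (2 - real (Suc N) * dist y d))"

definition cyl_bump :: "rat \<Rightarrow> ('a::metric_space \<times> nat) list \<Rightarrow> (nat \<Rightarrow> 'a) \<Rightarrow> real" where
  "cyl_bump q ds x = of_rat q * (\<Prod>i<length ds. bump (fst (ds ! i)) (snd (ds ! i)) (x i))"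

lemma bump_range: "0 \<le> bump d N y" "bump d N y \<le> 1"
  by (auto simp: bump_def)

lemma continuous_bump: "continuous_on UNIV (bump d N)"
  unfolding bump_def by (intro continuous_intros)

lemma cyl_cyl_bump: "cyl (cyl_bump q ds)"
  unfolding cyl_bump_def by (rule cyl.prod) (auto simp: continuous_bump bump_range)

text \<open>With \<open>r = 1 / (N + 1)\<close>, a bump is 1 up to distance \<open>r\<close> from
  its centre and 0 from distance \<open>2 * r\<close> on. If \<open>3 * r\<close> is below the
  radius of a ball around \<open>z\<close> inside \<open>U\<close>, any centre in \<open>D\<close>
  within \<open>r\<close> of \<open>z\<close> does.\<close>

lemma exists_bump:
  fixes z :: "'a::metric_space"
  assumes "open U" "z \<in> U" and D: "\<And>V. open V \<Longrightarrow> V \<noteq> {} \<Longrightarrow> \<exists>d\<in>D. d \<in> V"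
  shows "\<exists>d\<in>D. \<exists>N. bump d N z = 1 \<and> (\<forall>y. bump d N y \<noteq> 0 \<longrightarrow> y \<in> U)"
proof -
  obtain e where e: "0 < e" "ball z e \<subseteq> U" using assms(1,2) openE by blast
  obtain N where N: "inverse (real (Suc N)) < e / 3" using reals_Archimedean[of "e / 3"] e by auto
  define r where "r = inverse (real (Suc N))"
  have r: "0 < r" "real (Suc N) * r = 1" by (auto simp: r_def)
  obtain d where d: "d \<in> D" "d \<in> ball z r" using D[of "ball z r"] r by auto
  have "real (Suc N) * dist z d \<le> real (Suc N) * r"
    using d(2) by (intro mult_left_mono) (auto simp: mem_ball)
  then have "bump d N z = 1" using r(2) unfolding bump_def by linarith
  moreover have "y \<in> U" if "bump d N y \<noteq> 0" for y
  proof -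
    have "real (Suc N) * dist y d < 2"
      using that unfolding bump_def by linarith
    then have "real (Suc N) * dist y d < real (Suc N) * (2 * r)"
      using r(2) by linarith
    then have "dist y d < 2 * r" by (subst (asm) mult_less_cancel_left_pos) auto
    then have "dist z y < e" using d(2) N r_def dist_triangle[of z y d] by (auto simp: mem_ball dist_commute)
    then show ?thesis using e by auto
  qed
  ultimately show ?thesis using d(1) by auto
qed

text \<open>The open set where \<open>f\<close> exceeds \<open>q\<close> contains a box around
  \<open>x\<close> that restricts finitely many coordinates; each bump is supported in one side of
  it. Where all bumps are non-zero the point lies in the box, so \<open>f\<close> exceeds
  \<open>q\<close>, which bounds the product; elsewhere the product is 0, below \<open>f\<close> by
  non-negativity.\<close>

lemma exists_cyl_bump:
  fixes f :: "(nat \<Rightarrow> 'a::metric_space) \<Rightarrow> real"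
  assumes f: "continuous_on UNIV f" "\<And>x. 0 \<le> f x" and q: "0 \<le> q" "of_rat q < f x"
    and D: "\<And>V :: 'a set. open V \<Longrightarrow> V \<noteq> {} \<Longrightarrow> \<exists>d\<in>D. d \<in> V"
  shows "\<exists>ds\<in>lists (D \<times> UNIV). cyl_bump q ds x = of_rat q \<and> (\<forall>y. cyl_bump q ds y \<le> f y)"
proof -
  have "open {y. of_rat q < f y}" using f(1) by (intro open_Collect_less) (auto intro!: continuous_intros)
  then have "openin (product_topology (\<lambda>_. euclidean) UNIV) {y. of_rat q < f y}"
    by (simp add: euclidean_product_topology)
  from product_topology_open_contains_basis[OF this, of x] q
  obtain X where X: "x \<in> (\<Pi>\<^sub>E i\<in>UNIV. X i)" "\<And>i. open (X i)" "finite {i. X i \<noteq> UNIV}"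
      "(\<Pi>\<^sub>E i\<in>UNIV. X i) \<subseteq> {y. of_rat q < f y}"
    by auto
  \<comment> \<open>All restricted coordinates lie below \<open>k\<close>. Unrestricted ones below
    \<open>k\<close> receive a bump as well, so that the data form a list indexed by
    position.\<close>
  obtain k where k: "{i. X i \<noteq> UNIV} \<subseteq> {..<k}"
    using X(3) unfolding finite_nat_set_iff_bounded by auto
  have "\<forall>i. \<exists>p\<in>D \<times> UNIV. bump (fst p) (snd p) (x i) = 1 \<and> (\<forall>y. bump (fst p) (snd p) y \<noteq> 0 \<longrightarrow> y \<in> X i)"
    using exists_bump[OF X(2) _ D, of "x i" i for i] X(1) by (fastforce simp: PiE_iff)
  then obtain p where p: "\<And>i. p i \<in> D \<times> UNIV" "\<And>i. bump (fst (p i)) (snd (p i)) (x i) = 1"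
      "\<And>i y. bump (fst (p i)) (snd (p i)) y \<noteq> 0 \<Longrightarrow> y \<in> X i"
    by metis
  define ds where "ds = map p [0..<k]"
  have eq: "cyl_bump q ds y = of_rat q * (\<Prod>i<k. bump (fst (p i)) (snd (p i)) (y i))" for y
    by (auto simp: cyl_bump_def ds_def intro!: prod.cong)
  have "cyl_bump q ds y \<le> f y" for y
  proof (cases "\<forall>i<k. bump (fst (p i)) (snd (p i)) (y i) \<noteq> 0")
    case True
    have "y i \<in> X i" for i
      using True p(3)[of i "y i"] k by (cases "i < k") auto
    then have "y \<in> (\<Pi>\<^sub>E i\<in>UNIV. X i)" by (simp add: PiE_iff)
    then have "of_rat q < f y" using X(4) by auto
    moreover have "cyl_bump q ds y \<le> of_rat q"
      unfolding eq using q(1) by (intro mult_left_le prod_le_1) (auto simp: bump_range)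
    ultimately show ?thesis by linarith
  next
    case False
    then have "cyl_bump q ds y = 0" by (auto simp: eq intro: prod_zero)
    then show ?thesis using f(2) by simp
  qed
  moreover have "ds \<in> lists (D \<times> UNIV)" using p(1) unfolding ds_def in_lists_conv_set set_map by blast
  ultimately show ?thesis by (intro bexI[of _ ds]) (auto simp: eq p)
qed

text \<open>The cylinder bumps lying below \<open>f\<close>, with centres in a countable dense set
  and rational heights, form a countable family. Running maxima along an enumeration remain below
  \<open>f\<close> and in the closure, and they reach every level under \<open>f x\<close> at every
  \<open>x\<close>.\<close>

lemma cyl_approximation:
  fixes f :: "(nat \<Rightarrow> 'a::{metric_space, second_countable_topology}) \<Rightarrow> real"
  assumes f: "continuous_on UNIV f" "\<And>x. 0 \<le> f x"
  shows "\<exists>g :: nat \<Rightarrow> _. (\<forall>m. cyl_closure (g m) \<and> continuous_on UNIV (g m)) \<and> (\<forall>m x. 0 \<le> g m x \<and> g m x \<le> f x) \<and>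
    (\<forall>x. (\<lambda>m. g m x) \<longlonglongrightarrow> f x)"
proof -
  obtain D :: "'a set" where D: "countable D" "\<And>V. open V \<Longrightarrow> V \<noteq> {} \<Longrightarrow> \<exists>d\<in>D. d \<in> V"
    using countable_dense_setE by metis
  define G where "G = {h \<in> (\<lambda>(q, ds). cyl_bump q ds) ` ({q. 0 \<le> q} \<times> lists (D \<times> UNIV)). \<forall>x. h x \<le> f x}"
  have G: "cyl h \<and> (\<forall>x. 0 \<le> h x \<and> h x \<le> f x)" if "h \<in> G" for h
    using that by (auto simp: G_def cyl_cyl_bump) (auto simp: cyl_bump_def bump_range intro!: mult_nonneg_nonneg prod_nonneg)
  have "countable G"
    unfolding G_def using D(1)
    by (intro countable_Collect countable_image countable_SIGMA countable_lists) (auto intro: countable_subset[OF subset_UNIV])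
  \<comment> \<open>The zero function makes the family non-empty, so an enumeration exists.\<close>
  moreover have "cyl_bump 0 [] \<in> G"
    unfolding G_def using f(2) by (auto simp: cyl_bump_def intro!: image_eqI[of _ _ "(0, [])"])
  ultimately obtain e :: "nat \<Rightarrow> _" where e: "range e = G"
    by (metis range_from_nat_into empty_iff)
  define g where "g m x = Max ((\<lambda>j. e j x) ` {..m})" for m x
  have eG: "e j \<in> G" for j using e by auto
  have ge: "e j x \<le> g m x" if "j \<le> m" for j m x
    unfolding g_def using that by (intro Max_ge) auto
  have le: "g m x \<le> f x" for m x
    unfolding g_def using G[OF eG] by (subst Max_le_iff) auto
  have nn: "0 \<le> g m x" for m x
    using ge[of 0 m x] G[OF eG[of 0]] by (auto intro: order_trans)
  have "(\<lambda>m. g m x) \<longlonglongrightarrow> f x" for x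
  proof (rule LIMSEQ_I)
    fix \<epsilon> :: real assume \<epsilon>: "0 < \<epsilon>"
    \<comment> \<open>If \<open>f x\<close> is below the tolerance, any non-negative member will do;
      otherwise a rational strictly between \<open>f x - \<epsilon>\<close> and \<open>f x\<close>
      is non-negative and is the height of a suitable bump.\<close>
    obtain j where j: "f x - \<epsilon> < e j x"
    proof (cases "f x < \<epsilon>")
      case True
      then show ?thesis using that[of 0] G[OF eG[of 0]] by (smt (verit))
    next
      case False
      obtain q where q: "f x - \<epsilon> < of_rat q" "of_rat q < f x" using of_rat_dense[of "f x - \<epsilon>" "f x"] \<epsilon> by auto
      have "0 \<le> (of_rat q :: real)" using q False by linarith
      then have q0: "0 \<le> q" by simp
      from exists_cyl_bump[OF f q0 q(2) D(2)] obtain ds where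
        "ds\<in>lists (D \<times> UNIV)" "cyl_bump q ds x = of_rat q" "\<forall>y. cyl_bump q ds y \<le> f y" by auto
      then have "cyl_bump q ds \<in> range e" "f x - \<epsilon> < cyl_bump q ds x" using q0 q by (auto simp: G_def e)
      then show ?thesis using that by (metis rangeE)
    qed
    have "norm (g m x - f x) < \<epsilon>" if "j \<le> m" for m
      using ge[OF that, of x] le[of m x] j by auto
    then show "\<exists>no. \<forall>n\<ge>no. norm (g n x - f x) < \<epsilon>" by auto
  qed
  moreover have "cyl_closure (g m) \<and> continuous_on UNIV (g m)" for m
    unfolding g_def using cyl_closure_Max[of e m] G[OF eG] by auto
  ultimately show ?thesis using le nn by (intro exI[of _ g]) auto
qed

section \<open>Product test functions determine weak convergence\<close>

text \<open>Convergence extends from products to their span by linearity and to uniform limits by a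
  three-epsilon argument. Approximation from below then gives an asymptotic lower bound for
  non-negative bounded continuous functions, which suffices because \<open>f + B\<close> and
  \<open>B - f\<close> are both of this kind.\<close>

lemma weak_conv_meas_sequences:
  fixes Ms :: "nat \<Rightarrow> (nat \<Rightarrow> 'a::polish_space) measure"
  assumes Ms: "\<And>n. prob_space (Ms n)" "\<And>n. sets (Ms n) = sets borel"
    and M: "prob_space M" "sets M = sets borel"
    and conv: "\<And>(h :: nat \<Rightarrow> 'a \<Rightarrow> real) k. (\<And>i. continuous_on UNIV (h i)) \<Longrightarrow> (\<And>i y. 0 \<le> h i y \<and> h i y \<le> 1) \<Longrightarrow>
      (\<lambda>n. \<integral>x. (\<Prod>i<k. h i (x i)) \<partial>Ms n) \<longlonglongrightarrow> (\<integral>x. (\<Prod>i<k. h i (x i)) \<partial>M)"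
  shows "weak_conv_meas Ms M"
proof -
  interpret M: prob_space M by fact
  interpret Ms: prob_space "Ms n" for n by fact
  have meas: "f \<in> borel_measurable M" "f \<in> borel_measurable (Ms n)" if "continuous_on UNIV f" for f :: "(nat \<Rightarrow> 'a) \<Rightarrow> real" and n
    using borel_measurable_continuous_onI[OF that] Ms(2) M(2) by (auto cong: measurable_cong_sets)
  have int: "integrable M f" "integrable (Ms n) f" if "continuous_on UNIV f" "\<And>x. \<bar>f x\<bar> \<le> B" for f :: "(nat \<Rightarrow> 'a) \<Rightarrow> real" and n B
    using that meas by (auto intro!: M.integrable_const_bound[of _ B] Ms.integrable_const_bound[of _ B])
  have cyl: "(\<lambda>n. \<integral>x. f x \<partial>Ms n) \<longlonglongrightarrow> (\<integral>x. f x \<partial>M)" if "cyl f" for f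
    using that
  proof induction
    case (prod h c k)
    show ?case using conv[of h k] prod by (auto intro!: tendsto_mult_left)
  next
    case (add f g)
    have "integrable M f" "integrable M g" "integrable (Ms n) f" "integrable (Ms n) g" for n
      using cyl_continuous_bounded[OF add(1)] cyl_continuous_bounded[OF add(2)] int by blast+
    then show ?case using tendsto_add[OF add(3,4)] by simp
  qed
  have closure: "(\<lambda>n. \<integral>x. f x \<partial>Ms n) \<longlonglongrightarrow> (\<integral>x. f x \<partial>M)"
    if f: "cyl_closure f" "continuous_on UNIV f" "\<And>x. \<bar>f x\<bar> \<le> B" for f B
  proof (rule LIMSEQ_I)
    fix e :: real assume e: "0 < e"
    then obtain p where p: "cyl p" "\<And>x. \<bar>f x - p x\<bar> < e / 3"
      using f(1) unfolding cyl_closure_def by (metis divide_pos_pos zero_less_numeral)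
    obtain C where C: "continuous_on UNIV p" "\<And>x. \<bar>p x\<bar> \<le> C" using cyl_continuous_bounded[OF p(1)] by auto
    have diff: "\<bar>(\<integral>x. f x \<partial>N) - (\<integral>x. p x \<partial>N)\<bar> \<le> e / 3" if "prob_space N" "integrable N f" "integrable N p" for N
    proof -
      interpret N: prob_space N by fact
      have "\<bar>(\<integral>x. f x \<partial>N) - (\<integral>x. p x \<partial>N)\<bar> = \<bar>\<integral>x. f x - p x \<partial>N\<bar>" using that by simp
      also have "\<dots> \<le> (\<integral>x. \<bar>f x - p x\<bar> \<partial>N)" by simp
      also have "\<dots> \<le> e / 3" using that p(2) by (intro N.integral_le_const) (auto intro: less_imp_le)
      finally show ?thesis .
    qed
    obtain no where no: "\<And>n. n \<ge> no \<Longrightarrow> \<bar>(\<integral>x. p x \<partial>Ms n) - (\<integral>x. p x \<partial>M)\<bar> < e / 3"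
      using LIMSEQ_D[OF cyl[OF p(1)], of "e / 3"] e by auto
    have "norm ((\<integral>x. f x \<partial>Ms n) - (\<integral>x. f x \<partial>M)) < e" if "n \<ge> no" for n
    proof -
      have "\<bar>(\<integral>x. f x \<partial>Ms n) - (\<integral>x. p x \<partial>Ms n)\<bar> \<le> e / 3" "\<bar>(\<integral>x. f x \<partial>M) - (\<integral>x. p x \<partial>M)\<bar> \<le> e / 3"
        by (rule diff; intro Ms M int[OF f(2,3)] int[OF C])+
      with no[OF that] show ?thesis unfolding real_norm_def by linarith
    qed
    then show "\<exists>no. \<forall>n\<ge>no. norm ((\<integral>x. f x \<partial>Ms n) - (\<integral>x. f x \<partial>M)) < e" by auto
  qed
  \<comment> \<open>Approximation from below gives only one inequality: under \<open>Ms n\<close>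
    just \<open>g m \<le> f\<close> is used, while the limit in \<open>m\<close> is taken under the
    single measure \<open>M\<close>.\<close>
  have liminf: "\<forall>\<^sub>F n in sequentially. (\<integral>x. f x \<partial>M) - e < (\<integral>x. f x \<partial>Ms n)"
    if f: "continuous_on UNIV f" "\<And>x. 0 \<le> f x" "\<And>x. f x \<le> B" and e: "0 < e" for f :: "(nat \<Rightarrow> 'a) \<Rightarrow> real" and e B
  proof -
    obtain g where g: "\<And>m. cyl_closure (g m)" "\<And>m. continuous_on UNIV (g m)" "\<And>m x. 0 \<le> g m x" "\<And>m x. g m x \<le> f x"
      "\<And>x. (\<lambda>m. g m x) \<longlonglongrightarrow> f x"
      using cyl_approximation[OF f(1,2)] by metis
    have gB: "\<bar>g m x\<bar> \<le> B" "\<bar>f x\<bar> \<le> B" for m x using g(3)[of m x] g(4)[of m x] f(2,3)[of x] by auto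
    have "(\<lambda>m. \<integral>x. g m x \<partial>M) \<longlonglongrightarrow> (\<integral>x. f x \<partial>M)"
      by (rule integral_dominated_convergence[where w="\<lambda>_. B"]) (use meas f g gB in auto)
    then have "\<forall>\<^sub>F m in sequentially. (\<integral>x. f x \<partial>M) - e < (\<integral>x. g m x \<partial>M)"
      using e by (intro order_tendstoD) auto
    then obtain m where m: "(\<integral>x. f x \<partial>M) - e < (\<integral>x. g m x \<partial>M)"
      by (auto simp: eventually_sequentially)
    have "\<forall>\<^sub>F n in sequentially. (\<integral>x. f x \<partial>M) - e < (\<integral>x. g m x \<partial>Ms n)"
      by (rule order_tendstoD(1)[OF closure[OF g(1,2) gB(1)] m])
    then show ?thesis
    proof eventually_elim
      case (elim n)
      have "(\<integral>x. g m x \<partial>Ms n) \<le> (\<integral>x. f x \<partial>Ms n)"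
        using g(4) by (intro integral_mono int[OF g(2) gB(1)] int[OF f(1) gB(2)])
      with elim show ?case by linarith
    qed
  qed
  show ?thesis
    unfolding weak_conv_meas_def
  proof (intro allI impI, elim conjE)
    fix f :: "(nat \<Rightarrow> 'a) \<Rightarrow> real"
    assume f: "continuous_on UNIV f" "bounded (range f)"
    obtain B where B: "\<And>x. \<bar>f x\<bar> \<le> B" using f(2) by (auto simp: bounded_iff)
    note I = int[OF f(1) B]
    show "(\<lambda>n. \<integral>x. f x \<partial>Ms n) \<longlonglongrightarrow> (\<integral>x. f x \<partial>M)"
    proof (rule order_tendstoI)
      fix a assume a: "a < (\<integral>x. f x \<partial>M)"
      \<comment> \<open>The lower bound for \<open>f + B\<close> excludes limit points of the
        integrals below the target; the one for \<open>B - f\<close> below excludes those above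
        it.\<close>
      have b: "0 \<le> f x + B" "f x + B \<le> 2 * B" for x using B[of x] by linarith+
      have "\<forall>\<^sub>F n in sequentially. (\<integral>x. f x + B \<partial>M) - ((\<integral>x. f x \<partial>M) - a) < (\<integral>x. f x + B \<partial>Ms n)"
        using f(1) a by (intro liminf[OF _ b]) (auto intro!: continuous_intros)
      then show "\<forall>\<^sub>F n in sequentially. a < (\<integral>x. f x \<partial>Ms n)"
        by eventually_elim (use I in \<open>simp add: M.prob_space Ms.prob_space\<close>)
    next
      fix a assume a: "(\<integral>x. f x \<partial>M) < a"
      have b: "0 \<le> B - f x" "B - f x \<le> 2 * B" for x using B[of x] by linarith+
      have "\<forall>\<^sub>F n in sequentially. (\<integral>x. B - f x \<partial>M) - (a - (\<integral>x. f x \<partial>M)) < (\<integral>x. B - f x \<partial>Ms n)"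
        using f(1) a by (intro liminf[OF _ b]) (auto intro!: continuous_intros)
      then show "\<forall>\<^sub>F n in sequentially. (\<integral>x. f x \<partial>Ms n) < a"
        by eventually_elim (use I in \<open>simp add: M.prob_space Ms.prob_space\<close>)
    qed
  qed
qed

section \<open>Convergence for vanishing and for full tie probability\<close>

lemma integral_abs_diff_le:
  fixes f g h :: "'b \<Rightarrow> real"
  assumes "integrable M f" "integrable M g" "integrable M h" "AE x in M. \<bar>f x - g x\<bar> \<le> h x"
  shows "\<bar>(\<integral>x. f x \<partial>M) - (\<integral>x. g x \<partial>M)\<bar> \<le> (\<integral>x. h x \<partial>M)"
proof -
  have "\<bar>(\<integral>x. f x \<partial>M) - (\<integral>x. g x \<partial>M)\<bar> = \<bar>\<integral>x. f x - g x \<partial>M\<bar>" using assms by simp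
  also have "\<dots> \<le> (\<integral>x. \<bar>f x - g x\<bar> \<partial>M)" by simp
  also have "\<dots> \<le> (\<integral>x. h x \<partial>M)" using assms by (intro integral_mono_AE) auto
  finally show ?thesis .
qed

text \<open>Arguments closer than \<open>d\<close> are handled by uniform continuity on the compact
  interval; otherwise \<open>2 * G\<close>, with \<open>G\<close> a bound for \<open>g\<close>, is
  at most \<open>(2 * G / d) * \<bar>a - b\<bar>\<close>. The affine form can be integrated
  directly, so a bound on the mean distance suffices for every continuous \<open>g\<close>.\<close>

lemma continuous_affine_modulus:
  fixes g :: "real \<Rightarrow> real"
  assumes g: "continuous_on UNIV g" and e: "0 < e"
  shows "\<exists>C\<ge>0. \<forall>a b. \<bar>a\<bar> \<le> B \<longrightarrow> \<bar>b\<bar> \<le> B \<longrightarrow> \<bar>g a - g b\<bar> \<le> e + C * \<bar>a - b\<bar>"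
proof -
  have c: "continuous_on {-B..B} g" by (rule continuous_on_subset[OF g]) simp
  obtain d where d: "0 < d" "\<And>a b. a \<in> {-B..B} \<Longrightarrow> b \<in> {-B..B} \<Longrightarrow> dist b a < d \<Longrightarrow> dist (g b) (g a) < e"
    using compact_uniformly_continuous[OF c] e unfolding uniformly_continuous_on_def by (metis compact_Icc)
  obtain G where G: "\<And>a. a \<in> {-B..B} \<Longrightarrow> \<bar>g a\<bar> \<le> G" "0 < G"
    using compact_imp_bounded[OF compact_continuous_image[OF c]] unfolding bounded_pos by force
  have "\<bar>g a - g b\<bar> \<le> e + (2 * G / d) * \<bar>a - b\<bar>" if ab: "\<bar>a\<bar> \<le> B" "\<bar>b\<bar> \<le> B" for a b
  proof (cases "\<bar>a - b\<bar> < d")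
    case True
    then have "\<bar>g a - g b\<bar> < e" using d(2)[of b a] ab by (auto simp: dist_real_def abs_le_iff)
    moreover have "0 \<le> (2 * G / d) * \<bar>a - b\<bar>" using d G by auto
    ultimately show ?thesis by linarith
  next
    case False
    have "\<bar>g a - g b\<bar> \<le> 2 * G" using G(1)[of a] G(1)[of b] ab by (auto simp: abs_le_iff)
    also have "\<dots> = (2 * G / d) * d" using d by simp
    also have "\<dots> \<le> (2 * G / d) * \<bar>a - b\<bar>" using False d G by (intro mult_left_mono) auto
    finally show ?thesis using e by linarith
  qed
  then show ?thesis using d G by (intro exI[of _ "2 * G / d"]) auto
qed

text \<open>\<open>C\<close> may depend on \<open>e\<close> but not on \<open>n\<close>: for fixed
  \<open>e\<close> the term \<open>C * d n\<close> vanishes in the limit, and \<open>e\<close> is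
  arbitrary. All four limits of the theorem are brought into this form.\<close>

lemma tendsto_of_affine_bound:
  fixes a b d :: "nat \<Rightarrow> real"
  assumes bound: "\<And>e. 0 < e \<Longrightarrow> \<exists>C. \<forall>n. \<bar>a n - b n\<bar> \<le> e + C * d n"
    and d: "d \<longlonglongrightarrow> 0" and b: "b \<longlonglongrightarrow> l"
  shows "a \<longlonglongrightarrow> l"
proof -
  have "(\<lambda>n. a n - b n) \<longlonglongrightarrow> 0"
  proof (rule LIMSEQ_I)
    fix e :: real assume e: "0 < e"
    obtain C where C: "\<And>n. \<bar>a n - b n\<bar> \<le> e / 2 + C * d n" using bound[of "e / 2"] e by auto
    have "(\<lambda>n. C * d n) \<longlonglongrightarrow> 0" using tendsto_mult_left[OF d, of C] by simp
    then have "\<forall>\<^sub>F n in sequentially. C * d n < e / 2" using e by (intro order_tendstoD) auto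
    then obtain N where "\<And>n. n \<ge> N \<Longrightarrow> C * d n < e / 2" by (auto simp: eventually_sequentially)
    then have "norm (a n - b n - 0) < e" if "n \<ge> N" for n
      using C[of n] that by fastforce
    then show "\<exists>no. \<forall>n\<ge>no. norm (a n - b n - 0) < e" by auto
  qed
  from tendsto_add[OF this b] show ?thesis by simp
qed

section \<open>Deviation bounds in terms of the tie probability\<close>

context species_process
begin

lemma integrable_prod_integral_mu:
  fixes h :: "nat \<Rightarrow> 'a \<Rightarrow> real"
  assumes h [measurable]: "\<And>i. h i \<in> borel_measurable borel" and h01: "\<And>i y. 0 \<le> h i y \<and> h i y \<le> 1"
  shows "integrable P (\<lambda>\<omega>. \<Prod>i<k. \<integral>y. h i y \<partial>mu \<omega>)"
proof (rule integrable_const_bound[of _ 1])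
  have [measurable]: "(\<lambda>\<omega>. \<integral>y. h i y \<partial>mu \<omega>) \<in> borel_measurable P" for i
    by (rule measurable_integral_mu) measurable
  show "(\<lambda>\<omega>. \<Prod>i<k. \<integral>y. h i y \<partial>mu \<omega>) \<in> borel_measurable P" by measurable
  show "AE \<omega> in P. norm (\<Prod>i<k. \<integral>y. h i y \<partial>mu \<omega>) \<le> 1"
    using AE_good
  proof eventually_elim
    case (elim \<omega>)
    have "\<bar>\<integral>y. h i y \<partial>mu \<omega>\<bar> \<le> 1" for i
      by (rule integral_mu_bound[OF elim h]) (use h01 in auto)
    then show ?case by (auto simp: abs_prod intro!: prod_le_1)
  qed
qed

text \<open>For numbers of modulus at most 1 the difference of two products is at most the sum of
  the differences of the factors. This leaves \<open>k\<close> single deviations, each bounded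
  through the second moment.\<close>

lemma prod_deviation_small_tie:
  fixes h :: "nat \<Rightarrow> 'a \<Rightarrow> real"
  assumes h [measurable]: "\<And>i. h i \<in> borel_measurable borel" and h01: "\<And>i y. 0 \<le> h i y \<and> h i y \<le> 1"
  shows "\<bar>(\<integral>\<omega>. (\<Prod>i<k. \<integral>y. h i y \<partial>mu \<omega>) \<partial>P) - (\<Prod>i<k. \<integral>y. h i y \<partial>lam)\<bar> \<le>
    real k * (2 * sqrt (\<Sum>j. \<integral>\<omega>. (w j \<omega>)\<^sup>2 \<partial>P))"
proof -
  interpret lam: prob_space lam by (rule prob_space_lam)
  have h1: "\<bar>h i y\<bar> \<le> 1" for i y using h01[of i y] by auto
  have int: "integrable P (\<lambda>\<omega>. \<bar>(\<integral>y. h i y \<partial>mu \<omega>) - (\<integral>y. h i y \<partial>lam)\<bar>)" for i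
    using integrable_bounded_mu[OF h h1, of i] by auto
  have "\<bar>(\<integral>\<omega>. (\<Prod>i<k. \<integral>y. h i y \<partial>mu \<omega>) \<partial>P) - (\<integral>\<omega>. (\<Prod>i<k. \<integral>y. h i y \<partial>lam) \<partial>P)\<bar> \<le>
      (\<integral>\<omega>. (\<Sum>i<k. \<bar>(\<integral>y. h i y \<partial>mu \<omega>) - (\<integral>y. h i y \<partial>lam)\<bar>) \<partial>P)"
  proof (rule integral_abs_diff_le)
    show "AE \<omega> in P. \<bar>(\<Prod>i<k. \<integral>y. h i y \<partial>mu \<omega>) - (\<Prod>i<k. \<integral>y. h i y \<partial>lam)\<bar>
        \<le> (\<Sum>i<k. \<bar>(\<integral>y. h i y \<partial>mu \<omega>) - (\<integral>y. h i y \<partial>lam)\<bar>)"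
      using AE_good
    proof eventually_elim
      case (elim \<omega>)
      have "norm (\<integral>y. h i y \<partial>mu \<omega>) \<le> 1" for i
        using integral_mu_bound[OF elim h h1] by simp
      moreover have "norm (\<integral>y. h i y \<partial>lam) \<le> 1" for i
        using h01 by (auto intro!: integral_nonneg_AE lam.integral_le_const lam.integrable_const_bound[of _ 1])
      ultimately show ?case
        using norm_prod_diff[of "{..<k}" "\<lambda>i. \<integral>y. h i y \<partial>mu \<omega>" "\<lambda>i. \<integral>y. h i y \<partial>lam"] by simp
    qed
  qed (use int integrable_prod_integral_mu[OF h h01] in auto)
  also have "\<dots> = (\<Sum>i<k. \<integral>\<omega>. \<bar>(\<integral>y. h i y \<partial>mu \<omega>) - (\<integral>y. h i y \<partial>lam)\<bar> \<partial>P)"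
    using int by simp
  also have "\<dots> \<le> (\<Sum>i<k. 2 * sqrt (\<Sum>j. \<integral>\<omega>. (w j \<omega>)\<^sup>2 \<partial>P))"
    using expectation_deviation_mu[OF h h1] by (intro sum_mono) simp
  finally show ?thesis by (simp add: prob_space)
qed

text \<open>The concentration error at \<open>\<omega>\<close> is a multiple of this deficit;
  integrating turns it into one minus the tie probability.\<close>

lemma expectation_tie_deficit:
  "integrable P (\<lambda>\<omega>. 1 - (\<Sum>j. (w j \<omega>)\<^sup>2))"
  "(\<integral>\<omega>. 1 - (\<Sum>j. (w j \<omega>)\<^sup>2) \<partial>P) = 1 - (\<Sum>j. \<integral>\<omega>. (w j \<omega>)\<^sup>2 \<partial>P)"
proof -
  have "integrable P (\<lambda>\<omega>. \<Sum>j. (w j \<omega>)\<^sup>2)"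
  proof (rule integrable_const_bound[of _ 1])
    show "AE \<omega> in P. norm (\<Sum>j. (w j \<omega>)\<^sup>2) \<le> 1"
      using AE_good
    proof eventually_elim
      case (elim \<omega>)
      have "(\<Sum>j. (w j \<omega>)\<^sup>2) \<le> (\<Sum>j. w j \<omega>)" by (intro suminf_le good_w elim)
      moreover have "0 \<le> (\<Sum>j. (w j \<omega>)\<^sup>2)" by (intro suminf_nonneg good_w elim) simp
      ultimately show ?case using good_w(4)[OF elim] by simp
    qed
  qed measurable
  then show "integrable P (\<lambda>\<omega>. 1 - (\<Sum>j. (w j \<omega>)\<^sup>2))"
    "(\<integral>\<omega>. 1 - (\<Sum>j. (w j \<omega>)\<^sup>2) \<partial>P) = 1 - (\<Sum>j. \<integral>\<omega>. (w j \<omega>)\<^sup>2 \<partial>P)"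
    using sums_unique[OF sums_expectation_w_squared] by (auto simp: prob_space)
qed

text \<open>Compare with the values at a common concentration point: the \<open>k\<close> factors
  and the integral of the product each contribute an error of twice the deficit, whence
  \<open>2 * real k + 2\<close>. The mean of the integral of the product is exactly its integral
  against \<open>lam\<close>.\<close>

lemma prod_deviation_large_tie:
  fixes h :: "nat \<Rightarrow> 'a \<Rightarrow> real"
  assumes h [measurable]: "\<And>i. h i \<in> borel_measurable borel" and h01: "\<And>i y. 0 \<le> h i y \<and> h i y \<le> 1"
  shows "\<bar>(\<integral>\<omega>. (\<Prod>i<k. \<integral>y. h i y \<partial>mu \<omega>) \<partial>P) - (\<integral>y. (\<Prod>i<k. h i y) \<partial>lam)\<bar> \<le>
    (2 * real k + 2) * (1 - (\<Sum>j. \<integral>\<omega>. (w j \<omega>)\<^sup>2 \<partial>P))"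
proof -
  let ?V = "\<lambda>\<omega>. 1 - (\<Sum>j. (w j \<omega>)\<^sup>2)" and ?H = "\<lambda>y. \<Prod>i<k. h i y"
  have h1: "\<bar>h i y\<bar> \<le> 1" for i y using h01[of i y] by auto
  have H: "?H \<in> borel_measurable borel" by measurable
  have H1: "\<bar>?H y\<bar> \<le> 1" for y using h1 by (auto simp: abs_prod intro!: prod_le_1)
  have "\<bar>(\<integral>\<omega>. (\<Prod>i<k. \<integral>y. h i y \<partial>mu \<omega>) \<partial>P) - (\<integral>\<omega>. (\<integral>y. ?H y \<partial>mu \<omega>) \<partial>P)\<bar> \<le>
      (\<integral>\<omega>. (2 * real k + 2) * ?V \<omega> \<partial>P)"
  proof (rule integral_abs_diff_le)
    show "AE \<omega> in P. \<bar>(\<Prod>i<k. \<integral>y. h i y \<partial>mu \<omega>) - (\<integral>y. ?H y \<partial>mu \<omega>)\<bar> \<le> (2 * real k + 2) * ?V \<omega>"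
      using AE_good
    proof eventually_elim
      case (elim \<omega>)
      obtain z where z: "\<And>(f :: 'a \<Rightarrow> real) B. f \<in> borel_measurable borel \<Longrightarrow> (\<forall>y. \<bar>f y\<bar> \<le> B) \<Longrightarrow>
          \<bar>(\<integral>y. f y \<partial>mu \<omega>) - f z\<bar> \<le> 2 * B * ?V \<omega>"
        using exists_concentration_point[OF elim] by blast
      have "norm (\<integral>y. h i y \<partial>mu \<omega>) \<le> 1" for i
        using integral_mu_bound[OF elim h h1] by simp
      then have "\<bar>(\<Prod>i<k. \<integral>y. h i y \<partial>mu \<omega>) - ?H z\<bar> \<le> (\<Sum>i<k. \<bar>(\<integral>y. h i y \<partial>mu \<omega>) - h i z\<bar>)"
        using norm_prod_diff[of "{..<k}" "\<lambda>i. \<integral>y. h i y \<partial>mu \<omega>" "\<lambda>i. h i z"] h1 by simp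
      also have "\<dots> \<le> (\<Sum>i<k. 2 * ?V \<omega>)"
        using z[OF h, of _ 1] h1 by (intro sum_mono) simp
      finally have "\<bar>(\<Prod>i<k. \<integral>y. h i y \<partial>mu \<omega>) - ?H z\<bar> \<le> 2 * real k * ?V \<omega>" by (simp add: algebra_simps)
      moreover have "\<bar>(\<integral>y. ?H y \<partial>mu \<omega>) - ?H z\<bar> \<le> 2 * 1 * ?V \<omega>" using H1 by (intro z H) auto
      ultimately show ?case by (simp add: distrib_right)
    qed
  qed (use expectation_tie_deficit(1) in \<open>auto intro!: integrable_prod_integral_mu h h01 integrable_bounded_mu[OF H H1]\<close>)
  then show ?thesis
    using expectation_tie_deficit by (simp add: expectation_integral_mu[OF H H1])
qed

lemma integrable_comp_integral_mu:
  fixes f :: "'a \<Rightarrow> real" and g :: "real \<Rightarrow> real"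
  assumes f [measurable]: "f \<in> borel_measurable borel"
    and g [measurable]: "g \<in> borel_measurable borel" and G: "\<And>a. \<bar>g a\<bar> \<le> G"
  shows "integrable P (\<lambda>\<omega>. g (\<integral>y. f y \<partial>mu \<omega>))"
proof (rule integrable_const_bound[of _ G])
  have [measurable]: "(\<lambda>\<omega>. \<integral>y. f y \<partial>mu \<omega>) \<in> borel_measurable P"
    by (rule measurable_integral_mu) fact
  show "(\<lambda>\<omega>. g (\<integral>y. f y \<partial>mu \<omega>)) \<in> borel_measurable P" by measurable
qed (use G in auto)

text \<open>Here \<open>c\<close> stands for the limit of the base integrals. Inserting the integral
  of \<open>f\<close> against \<open>lam\<close> splits the error into the fluctuation of
  \<open>mu\<close> and the bias of \<open>lam\<close>.\<close>

lemma comp_deviation_small_tie: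
  fixes f :: "'a \<Rightarrow> real" and g :: "real \<Rightarrow> real"
  assumes f [measurable]: "f \<in> borel_measurable borel" and B: "\<And>y. \<bar>f y\<bar> \<le> B"
    and g [measurable]: "g \<in> borel_measurable borel" and G: "\<And>a. \<bar>g a\<bar> \<le> G"
    and C: "0 \<le> C" "\<And>a. \<bar>a\<bar> \<le> B \<Longrightarrow> \<bar>g a - g c\<bar> \<le> e + C * \<bar>a - c\<bar>"
  shows "\<bar>(\<integral>\<omega>. g (\<integral>y. f y \<partial>mu \<omega>) \<partial>P) - g c\<bar> \<le>
    e + C * (2 * B * sqrt (\<Sum>j. \<integral>\<omega>. (w j \<omega>)\<^sup>2 \<partial>P) + \<bar>(\<integral>y. f y \<partial>lam) - c\<bar>)"
proof -
  let ?F = "\<lambda>\<omega>. \<integral>y. f y \<partial>mu \<omega>" and ?c = "\<integral>y. f y \<partial>lam"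
  have int: "integrable P (\<lambda>\<omega>. \<bar>?F \<omega> - ?c\<bar>)"
    using integrable_bounded_mu[OF f B] by auto
  have "\<bar>(\<integral>\<omega>. g (?F \<omega>) \<partial>P) - (\<integral>\<omega>. g c \<partial>P)\<bar> \<le> (\<integral>\<omega>. e + C * (\<bar>?F \<omega> - ?c\<bar> + \<bar>?c - c\<bar>) \<partial>P)"
  proof (rule integral_abs_diff_le)
    show "AE \<omega> in P. \<bar>g (?F \<omega>) - g c\<bar> \<le> e + C * (\<bar>?F \<omega> - ?c\<bar> + \<bar>?c - c\<bar>)"
      using AE_good
    proof eventually_elim
      case (elim \<omega>)
      have "\<bar>g (?F \<omega>) - g c\<bar> \<le> e + C * \<bar>?F \<omega> - c\<bar>"
        by (rule C(2)[OF integral_mu_bound[OF elim f B]])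
      also have "\<dots> \<le> e + C * (\<bar>?F \<omega> - ?c\<bar> + \<bar>?c - c\<bar>)"
        using C(1) by (intro add_left_mono mult_left_mono) auto
      finally show ?case .
    qed
  qed (use int in \<open>auto intro!: integrable_comp_integral_mu[OF f g G]\<close>)
  also have "\<dots> = e + C * ((\<integral>\<omega>. \<bar>?F \<omega> - ?c\<bar> \<partial>P) + \<bar>?c - c\<bar>)"
    using int by (simp add: prob_space)
  also have "\<dots> \<le> e + C * (2 * B * sqrt (\<Sum>j. \<integral>\<omega>. (w j \<omega>)\<^sup>2 \<partial>P) + \<bar>?c - c\<bar>)"
    using C(1) by (intro add_left_mono mult_left_mono add_right_mono expectation_deviation_mu[OF f B])
  finally show ?thesis by (simp add: prob_space)
qed

text \<open>At a common concentration point \<open>z\<close>, moving the integral of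
  \<open>f\<close> to \<open>f z\<close> inside \<open>g\<close> costs \<open>e\<close> plus
  \<open>C * (2 * B)\<close> times the deficit; moving the integral of \<open>g (f y)\<close> to
  \<open>g (f z)\<close> costs \<open>2 * G\<close> times it.\<close>

lemma comp_deviation_large_tie:
  fixes f :: "'a \<Rightarrow> real" and g :: "real \<Rightarrow> real"
  assumes f [measurable]: "f \<in> borel_measurable borel" and B: "\<And>y. \<bar>f y\<bar> \<le> B"
    and g [measurable]: "g \<in> borel_measurable borel" and G: "\<And>a. \<bar>g a\<bar> \<le> G"
    and C: "0 \<le> C" "\<And>a b. \<bar>a\<bar> \<le> B \<Longrightarrow> \<bar>b\<bar> \<le> B \<Longrightarrow> \<bar>g a - g b\<bar> \<le> e + C * \<bar>a - b\<bar>"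
  shows "\<bar>(\<integral>\<omega>. g (\<integral>y. f y \<partial>mu \<omega>) \<partial>P) - (\<integral>y. g (f y) \<partial>lam)\<bar> \<le>
    e + (C * (2 * B) + 2 * G) * (1 - (\<Sum>j. \<integral>\<omega>. (w j \<omega>)\<^sup>2 \<partial>P))"
proof -
  let ?F = "\<lambda>\<omega>. \<integral>y. f y \<partial>mu \<omega>" and ?V = "\<lambda>\<omega>. 1 - (\<Sum>j. (w j \<omega>)\<^sup>2)"
  have gf: "(\<lambda>y. g (f y)) \<in> borel_measurable borel" by measurable
  have "\<bar>(\<integral>\<omega>. g (?F \<omega>) \<partial>P) - (\<integral>\<omega>. (\<integral>y. g (f y) \<partial>mu \<omega>) \<partial>P)\<bar> \<le>
      (\<integral>\<omega>. e + (C * (2 * B) + 2 * G) * ?V \<omega> \<partial>P)"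
  proof (rule integral_abs_diff_le)
    show "AE \<omega> in P. \<bar>g (?F \<omega>) - (\<integral>y. g (f y) \<partial>mu \<omega>)\<bar> \<le> e + (C * (2 * B) + 2 * G) * ?V \<omega>"
      using AE_good
    proof eventually_elim
      case (elim \<omega>)
      obtain z where z: "\<And>(f :: 'a \<Rightarrow> real) B. f \<in> borel_measurable borel \<Longrightarrow> (\<forall>y. \<bar>f y\<bar> \<le> B) \<Longrightarrow>
          \<bar>(\<integral>y. f y \<partial>mu \<omega>) - f z\<bar> \<le> 2 * B * ?V \<omega>"
        using exists_concentration_point[OF elim] by blast
      have "\<bar>g (?F \<omega>) - g (f z)\<bar> \<le> e + C * \<bar>?F \<omega> - f z\<bar>"
        by (rule C(2)[OF integral_mu_bound[OF elim f B] B])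
      also have "\<dots> \<le> e + C * (2 * B * ?V \<omega>)"
        using C(1) B by (intro add_left_mono mult_left_mono z f) auto
      finally have "\<bar>g (?F \<omega>) - g (f z)\<bar> \<le> e + C * (2 * B * ?V \<omega>)" .
      moreover have "\<bar>(\<integral>y. g (f y) \<partial>mu \<omega>) - g (f z)\<bar> \<le> 2 * G * ?V \<omega>"
        using G by (intro z gf) auto
      ultimately have "\<bar>g (?F \<omega>) - (\<integral>y. g (f y) \<partial>mu \<omega>)\<bar> \<le> e + C * (2 * B * ?V \<omega>) + 2 * G * ?V \<omega>"
        by linarith
      then show ?case by (simp add: algebra_simps)
    qed
  qed (use expectation_tie_deficit(1) in \<open>auto intro!: integrable_comp_integral_mu[OF f g G] integrable_bounded_mu[OF gf G]\<close>)
  then show ?thesis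
    using expectation_tie_deficit by (simp add: expectation_integral_mu[OF gf G] prob_space)
qed

end

section \<open>Assembly of the limit theorem\<close>

lemma species_samplingE:
  assumes "species_sampling P mu lam rho" "prob_space P"
  shows "\<exists>w xi. species_process P mu lam w xi \<and> rho = (\<Sum>j. \<integral>\<omega>. (w j \<omega>)\<^sup>2 \<partial>P)"
  using assms(1) unfolding species_sampling_def
proof (elim exE conjE, goal_cases)
  case (1 w xi)
  then have "species_process P mu lam w xi"
    using assms(2) by (intro species_process.intro species_process_axioms.intro) simp_all
  with 1 show ?case by metis
qed

text \<open>The integrand depends on the first \<open>k\<close> coordinates only, and that marginal
  of the infinite product is the finite product measure, where the integral factorizes.\<close>

lemma integral_PiM_prod_UNIV:
  fixes h :: "nat \<Rightarrow> 'a \<Rightarrow> real"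
  assumes "prob_space M" and h: "\<And>i. integrable M (h i)"
  shows "(\<integral>x. (\<Prod>i<k. h i (x i)) \<partial>PiM UNIV (\<lambda>_. M)) = (\<Prod>i<k. \<integral>y. h i y \<partial>M)"
proof -
  interpret M: prob_space M by fact
  interpret product_prob_space "\<lambda>_ :: nat. M" UNIV by unfold_locales
  have [measurable]: "h i \<in> borel_measurable M" for i using h by auto
  have "(\<Prod>i<k. \<integral>y. h i y \<partial>M) = (\<integral>x. (\<Prod>i<k. h i (x i)) \<partial>PiM {..<k} (\<lambda>_. M))"
    using h by (subst product_integral_prod) auto
  also have "\<dots> = (\<integral>x. (\<Prod>i<k. h i (x i)) \<partial>distr (PiM UNIV (\<lambda>_. M)) (PiM {..<k} (\<lambda>_. M)) (\<lambda>x. restrict x {..<k}))"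
    by (subst distr_PiM_restrict_finite) auto
  also have "\<dots> = (\<integral>x. (\<Prod>i<k. h i (restrict x {..<k} i)) \<partial>PiM UNIV (\<lambda>_. M))"
    by (rule integral_distr) (auto intro!: measurable_restrict_subset borel_measurable_prod)
  also have "\<dots> = (\<integral>x. (\<Prod>i<k. h i (x i)) \<partial>PiM UNIV (\<lambda>_. M))"
    by (intro Bochner_Integration.integral_cong prod.cong refl) simp
  finally show ?thesis ..
qed

theorem theorem8:
  fixes mu0 :: "'a::polish_space measure"
    and mu0s :: "nat \<Rightarrow> 'a measure"
    and rho :: "nat \<Rightarrow> real"
    and P :: "nat \<Rightarrow> 'w measure"
    and mu :: "nat \<Rightarrow> 'w \<Rightarrow> 'a measure"
    and x :: "nat \<Rightarrow> nat \<Rightarrow> 'w \<Rightarrow> 'a"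
  assumes "diffuse_prob mu0"
    and "\<And>n. diffuse_prob (mu0s n)"
    and "weak_conv_meas mu0s mu0"
    and "\<And>n. 0 < rho n \<and> rho n < 1"
    and "\<And>n. prob_space (P n)"
    and "\<And>n. species_sampling (P n) (mu n) (mu0s n) (rho n)"
    and "\<And>n. cond_iid (P n) (mu n) (x n)"
  shows "(rho \<longlonglongrightarrow> 0 \<longrightarrow>
            rm_weak_conv_distr P mu mu0 (\<lambda>_. mu0) \<and>
            weak_conv_meas (\<lambda>n. distr (P n) borel (\<lambda>\<omega> i. x n i \<omega>)) (PiM UNIV (\<lambda>_. mu0)))
       \<and> (rho \<longlonglongrightarrow> 1 \<longrightarrow>
            rm_weak_conv_distr P mu mu0 (\<lambda>y. return borel y) \<and>
            weak_conv_meas (\<lambda>n. distr (P n) borel (\<lambda>\<omega> i. x n i \<omega>)) (distr mu0 borel (\<lambda>y i. y)))"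
proof -
  interpret M: prob_space mu0 using assms(1) by (simp add: diffuse_prob_def)
  have sets_mu0 [measurable_cong, simp]: "sets mu0 = sets borel" using assms(1) by (simp add: diffuse_prob_def)
  have "\<exists>w xi. species_process (P n) (mu n) (mu0s n) w xi \<and> rho n = (\<Sum>j. \<integral>\<omega>. (w j \<omega>)\<^sup>2 \<partial>P n)" for n
    using species_samplingE assms(5,6) by blast
  then obtain w xi where sp: "\<And>n. species_process (P n) (mu n) (mu0s n) (w n) (xi n)"
      and rho: "\<And>n. rho n = (\<Sum>j. \<integral>\<omega>. (w n j \<omega>)\<^sup>2 \<partial>P n)"
    by metis
  interpret S: species_process "P n" "mu n" "mu0s n" "w n" "xi n" for n by (rule sp)
  have xm [measurable]: "x n i \<in> measurable (P n) borel" for n i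
    using assms(7)[of n] by (simp add: cond_iid_def)
  \<comment> \<open>Coordinatewise measurability concerns the product sigma-algebra, which is the
    Borel one on a countable power of a second countable space.\<close>
  have xseq [measurable]: "(\<lambda>\<omega> i. x n i \<omega>) \<in> measurable (P n) borel" for n
    using measurable_abs_UNIV[of "\<lambda>i. x n i" "P n" "\<lambda>_. borel"]
    by (simp add: measurable_cong_sets[OF refl sets_PiM_equal_borel])
  have const [measurable]: "(\<lambda>y (i::nat). y) \<in> measurable mu0 borel"
    by (auto intro!: borel_measurable_continuous_onI continuous_intros cong: measurable_cong_sets)
  have lim0: "(\<lambda>n. \<integral>y. f y \<partial>mu0s n) \<longlonglongrightarrow> (\<integral>y. f y \<partial>mu0)"
    if "continuous_on UNIV f" "\<And>y. \<bar>f y\<bar> \<le> B" for f :: "'a \<Rightarrow> real" and B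
    using assms(3) that unfolding weak_conv_meas_def by (auto simp: bounded_iff)
  have prob_x: "prob_space (distr (P n) borel (\<lambda>\<omega> i. x n i \<omega>))" for n
    by (rule S.prob_space_distr) measurable
  have seq_h: "h i \<in> borel_measurable borel" "\<bar>h i y\<bar> \<le> 1" "integrable mu0 (h i)"
    if "\<And>i. continuous_on UNIV (h i)" "\<And>i y. 0 \<le> h i y \<and> h i y \<le> 1" for h :: "nat \<Rightarrow> 'a \<Rightarrow> real" and i y
  proof -
    show "\<bar>h i y\<bar> \<le> 1" for y using that(2)[of i y] by auto
    then show "integrable mu0 (h i)"
      using that by (intro M.integrable_const_bound[of _ 1]) (auto intro!: borel_measurable_continuous_onI cong: measurable_cong_sets)
  qed (use that in \<open>auto intro: borel_measurable_continuous_onI\<close>)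
  have prod_meas: "(\<lambda>z. \<Prod>i<k. h i (z i)) \<in> borel_measurable (borel :: (nat \<Rightarrow> 'a) measure)"
    if "\<And>i. continuous_on UNIV (h i)" for h :: "nat \<Rightarrow> 'a \<Rightarrow> real" and k
    using that by (intro borel_measurable_continuous_onI continuous_on_prod continuous_on_compose2[OF _ continuous_on_product_coordinates]) auto
  have law_x: "(\<integral>z. (\<Prod>i<k. h i (z i)) \<partial>distr (P n) borel (\<lambda>\<omega> i. x n i \<omega>)) =
      (\<integral>\<omega>. (\<Prod>i<k. \<integral>y. h i y \<partial>mu n \<omega>) \<partial>P n)"
    if "\<And>i. continuous_on UNIV (h i)" "\<And>i y. 0 \<le> h i y \<and> h i y \<le> 1" for h :: "nat \<Rightarrow> 'a \<Rightarrow> real" and k n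
    using integral_distr[OF xseq prod_meas[of h k, OF that(1)], of n] S.cond_iid_expectation[where h=h, OF assms(7) seq_h(1)[of h, OF that] that(2), of n k]
    by simp
  \<comment> \<open>A change of variables pulls both laws back to the underlying spaces.
    Measurability of the limit functional accompanies the limit because the change of variables on
    \<open>mu0\<close> relies on it.\<close>
  have rm: "rm_weak_conv_distr P mu mu0 m"
    if m: "\<And>(f :: 'a \<Rightarrow> real) (g :: real \<Rightarrow> real). continuous_on UNIV f \<Longrightarrow> bounded (range f) \<Longrightarrow> continuous_on UNIV g \<Longrightarrow> bounded (range g) \<Longrightarrow>
       (\<lambda>q. \<integral>y. f y \<partial>m q) \<in> borel_measurable mu0 \<and>
       (\<lambda>n. \<integral>\<omega>. g (\<integral>y. f y \<partial>mu n \<omega>) \<partial>P n) \<longlonglongrightarrow> (\<integral>q. g (\<integral>y. f y \<partial>m q) \<partial>mu0)" for m :: "'a \<Rightarrow> 'a measure"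
    unfolding rm_weak_conv_distr_def weak_conv_meas_def
  proof (intro allI impI, elim conjE)
    fix f :: "'a \<Rightarrow> real" and g :: "real \<Rightarrow> real"
    assume fg: "continuous_on UNIV f" "bounded (range f)" "continuous_on UNIV g" "bounded (range g)"
    have [measurable]: "g \<in> borel_measurable borel" "f \<in> borel_measurable borel"
      using fg by (auto intro: borel_measurable_continuous_onI)
    have [measurable]: "(\<lambda>\<omega>. \<integral>y. f y \<partial>mu n \<omega>) \<in> borel_measurable (P n)" for n
      by (rule S.measurable_integral_mu) measurable
    show "(\<lambda>n. \<integral>y. g y \<partial>distr (P n) borel (\<lambda>\<omega>. \<integral>y. f y \<partial>mu n \<omega>)) \<longlonglongrightarrow>
        (\<integral>y. g y \<partial>distr mu0 borel (\<lambda>q. \<integral>y. f y \<partial>m q))"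
      using m[OF fg] by (simp add: integral_distr)
  qed
  have A1: "rm_weak_conv_distr P mu mu0 (\<lambda>_. mu0)" if r0: "rho \<longlonglongrightarrow> 0"
  proof (rule rm)
    fix f :: "'a \<Rightarrow> real" and g :: "real \<Rightarrow> real"
    assume fg: "continuous_on UNIV f" "bounded (range f)" "continuous_on UNIV g" "bounded (range g)"
    have fgm: "g \<in> borel_measurable borel" "f \<in> borel_measurable borel"
      using fg by (auto intro: borel_measurable_continuous_onI)
    obtain B G where B: "\<And>y. \<bar>f y\<bar> \<le> B" and G: "\<And>a. \<bar>g a\<bar> \<le> G" using fg by (auto simp: bounded_iff)
    let ?c = "\<integral>y. f y \<partial>mu0"
    have fi: "integrable mu0 f"
      using fgm B by (intro M.integrable_const_bound[of _ B]) (auto cong: measurable_cong_sets)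
    \<comment> \<open>The modulus of \<open>g\<close> is available on the interval from
      \<open>-B\<close> to \<open>B\<close> only, so the limit point has to lie there.\<close>
    have "\<bar>?c\<bar> \<le> (\<integral>y. \<bar>f y\<bar> \<partial>mu0)" by simp
    also have "\<dots> \<le> B" using fi B by (intro M.integral_le_const) auto
    finally have c: "\<bar>?c\<bar> \<le> B" .
    have "(\<lambda>n. \<integral>\<omega>. g (\<integral>y. f y \<partial>mu n \<omega>) \<partial>P n) \<longlonglongrightarrow> g ?c"
    proof (rule tendsto_of_affine_bound)
      fix e :: real assume "0 < e"
      then obtain C where C: "0 \<le> C" "\<And>a b. \<bar>a\<bar> \<le> B \<Longrightarrow> \<bar>b\<bar> \<le> B \<Longrightarrow> \<bar>g a - g b\<bar> \<le> e + C * \<bar>a - b\<bar>"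
        using continuous_affine_modulus[OF fg(3)] by metis
      show "\<exists>C. \<forall>n. \<bar>(\<integral>\<omega>. g (\<integral>y. f y \<partial>mu n \<omega>) \<partial>P n) - g ?c\<bar> \<le>
          e + C * (2 * B * sqrt (rho n) + \<bar>(\<integral>y. f y \<partial>mu0s n) - ?c\<bar>)"
        using S.comp_deviation_small_tie[OF fgm(2) B fgm(1) G C(1) C(2)[OF _ c]] by (auto simp: rho)
    next
      \<comment> \<open>The first term vanishes with the tie probability, the second by weak
        convergence of the base measures.\<close>
      have "(\<lambda>n. 2 * B * sqrt (rho n) + \<bar>(\<integral>y. f y \<partial>mu0s n) - ?c\<bar>) \<longlonglongrightarrow> 2 * B * sqrt 0 + \<bar>?c - ?c\<bar>"
        using lim0[OF fg(1) B] r0 by (intro tendsto_intros)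
      then show "(\<lambda>n. 2 * B * sqrt (rho n) + \<bar>(\<integral>y. f y \<partial>mu0s n) - ?c\<bar>) \<longlonglongrightarrow> 0" by simp
    qed simp
    then show "(\<lambda>q. ?c) \<in> borel_measurable mu0 \<and>
       (\<lambda>n. \<integral>\<omega>. g (\<integral>y. f y \<partial>mu n \<omega>) \<partial>P n) \<longlonglongrightarrow> (\<integral>q. g ?c \<partial>mu0)"
      using M.prob_space by simp
  qed
  have A2: "weak_conv_meas (\<lambda>n. distr (P n) borel (\<lambda>\<omega> i. x n i \<omega>)) (PiM UNIV (\<lambda>_. mu0))" if r0: "rho \<longlonglongrightarrow> 0"
  proof (rule weak_conv_meas_sequences)
    show "prob_space (PiM (UNIV :: nat set) (\<lambda>_. mu0))" by (intro prob_space_PiM M.prob_space_axioms)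
    show "sets (PiM UNIV (\<lambda>_. mu0)) = sets (borel :: (nat \<Rightarrow> 'a) measure)"
      using sets_PiM_cong[of UNIV UNIV "\<lambda>_. mu0" "\<lambda>_. borel"] sets_PiM_equal_borel by auto
    fix h :: "nat \<Rightarrow> 'a \<Rightarrow> real" and k
    assume h: "\<And>i. continuous_on UNIV (h i)" "\<And>i y. 0 \<le> h i y \<and> h i y \<le> 1"
    have "(\<lambda>n. \<integral>\<omega>. (\<Prod>i<k. \<integral>y. h i y \<partial>mu n \<omega>) \<partial>P n) \<longlonglongrightarrow> (\<Prod>i<k. \<integral>y. h i y \<partial>mu0)"
    proof (rule tendsto_of_affine_bound)
      show "\<exists>C. \<forall>n. \<bar>(\<integral>\<omega>. (\<Prod>i<k. \<integral>y. h i y \<partial>mu n \<omega>) \<partial>P n) - (\<Prod>i<k. \<integral>y. h i y \<partial>mu0s n)\<bar> \<le>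
          e + C * sqrt (rho n)" if "0 < e" for e
        using S.prod_deviation_small_tie[where h=h, OF seq_h(1)[of h, OF h] h(2), of _ k] that
        by (intro exI[of _ "real k * 2"] allI) (simp add: rho add_increasing mult.assoc)
      show "(\<lambda>n. sqrt (rho n)) \<longlonglongrightarrow> 0" using tendsto_real_sqrt[OF r0] by simp
      show "(\<lambda>n. \<Prod>i<k. \<integral>y. h i y \<partial>mu0s n) \<longlonglongrightarrow> (\<Prod>i<k. \<integral>y. h i y \<partial>mu0)"
        by (intro tendsto_prod) (rule lim0[OF h(1) seq_h(2)[of h, OF h]])
    qed
    then show "(\<lambda>n. \<integral>z. (\<Prod>i<k. h i (z i)) \<partial>distr (P n) borel (\<lambda>\<omega> i. x n i \<omega>)) \<longlonglongrightarrow>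
        (\<integral>z. (\<Prod>i<k. h i (z i)) \<partial>PiM UNIV (\<lambda>_. mu0))"
      by (simp add: law_x[of h, OF h] integral_PiM_prod_UNIV[where h=h, OF M.prob_space_axioms seq_h(3)[of h, OF h]])
  qed (auto intro: prob_x)
  have B1: "rm_weak_conv_distr P mu mu0 (\<lambda>y. return borel y)" if r1: "rho \<longlonglongrightarrow> 1"
  proof (rule rm)
    fix f :: "'a \<Rightarrow> real" and g :: "real \<Rightarrow> real"
    assume fg: "continuous_on UNIV f" "bounded (range f)" "continuous_on UNIV g" "bounded (range g)"
    have fgm [measurable]: "g \<in> borel_measurable borel" "f \<in> borel_measurable borel"
      using fg by (auto intro: borel_measurable_continuous_onI)
    obtain B G where B: "\<And>y. \<bar>f y\<bar> \<le> B" and G: "\<And>a. \<bar>g a\<bar> \<le> G" using fg by (auto simp: bounded_iff)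
    have ret: "(\<integral>y. f y \<partial>return borel q) = f q" for q
      by (rule integral_return) auto
    have "(\<lambda>n. \<integral>\<omega>. g (\<integral>y. f y \<partial>mu n \<omega>) \<partial>P n) \<longlonglongrightarrow> (\<integral>q. g (f q) \<partial>mu0)"
    proof (rule tendsto_of_affine_bound)
      fix e :: real assume "0 < e"
      then obtain C where C: "0 \<le> C" "\<And>a b. \<bar>a\<bar> \<le> B \<Longrightarrow> \<bar>b\<bar> \<le> B \<Longrightarrow> \<bar>g a - g b\<bar> \<le> e + C * \<bar>a - b\<bar>"
        using continuous_affine_modulus[OF fg(3)] by metis
      show "\<exists>C. \<forall>n. \<bar>(\<integral>\<omega>. g (\<integral>y. f y \<partial>mu n \<omega>) \<partial>P n) - (\<integral>q. g (f q) \<partial>mu0s n)\<bar> \<le>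
          e + C * (1 - rho n)"
        using S.comp_deviation_large_tie[OF fgm(2) B fgm(1) G C] by (auto simp: rho)
    next
      show "(\<lambda>n. 1 - rho n) \<longlonglongrightarrow> 0" using tendsto_diff[OF tendsto_const r1, of 1] by simp
      \<comment> \<open>The composition of \<open>g\<close> with \<open>f\<close> is again bounded
        and continuous, so weak convergence of the base measures applies to it.\<close>
      show "(\<lambda>n. \<integral>q. g (f q) \<partial>mu0s n) \<longlonglongrightarrow> (\<integral>q. g (f q) \<partial>mu0)"
        by (rule lim0[OF _ G]) (use continuous_on_compose2[OF fg(3,1)] in auto)
    qed
    then show "(\<lambda>q. \<integral>y. f y \<partial>return borel q) \<in> borel_measurable mu0 \<and>
       (\<lambda>n. \<integral>\<omega>. g (\<integral>y. f y \<partial>mu n \<omega>) \<partial>P n) \<longlonglongrightarrow> (\<integral>q. g (\<integral>y. f y \<partial>return borel q) \<partial>mu0)"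
      unfolding ret by simp
  qed
  have B2: "weak_conv_meas (\<lambda>n. distr (P n) borel (\<lambda>\<omega> i. x n i \<omega>)) (distr mu0 borel (\<lambda>y i. y))" if r1: "rho \<longlonglongrightarrow> 1"
  proof (rule weak_conv_meas_sequences)
    show "prob_space (distr mu0 borel (\<lambda>y (i::nat). y))" by (rule M.prob_space_distr) measurable
    fix h :: "nat \<Rightarrow> 'a \<Rightarrow> real" and k
    assume h: "\<And>i. continuous_on UNIV (h i)" "\<And>i y. 0 \<le> h i y \<and> h i y \<le> 1"
    have "(\<lambda>n. \<integral>\<omega>. (\<Prod>i<k. \<integral>y. h i y \<partial>mu n \<omega>) \<partial>P n) \<longlonglongrightarrow> (\<integral>y. (\<Prod>i<k. h i y) \<partial>mu0)"
    proof (rule tendsto_of_affine_bound)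
      show "\<exists>C. \<forall>n. \<bar>(\<integral>\<omega>. (\<Prod>i<k. \<integral>y. h i y \<partial>mu n \<omega>) \<partial>P n) - (\<integral>y. (\<Prod>i<k. h i y) \<partial>mu0s n)\<bar> \<le>
          e + C * (1 - rho n)" if "0 < e" for e
        using S.prod_deviation_large_tie[where h=h, OF seq_h(1)[of h, OF h] h(2), of _ k] that
        by (intro exI[of _ "2 * real k + 2"] allI) (simp add: rho add_increasing)
      show "(\<lambda>n. 1 - rho n) \<longlonglongrightarrow> 0" using tendsto_diff[OF tendsto_const r1, of 1] by simp
      show "(\<lambda>n. \<integral>y. (\<Prod>i<k. h i y) \<partial>mu0s n) \<longlonglongrightarrow> (\<integral>y. (\<Prod>i<k. h i y) \<partial>mu0)"
        using h seq_h(2)[of h, OF h] by (intro lim0[of _ 1]) (auto intro!: continuous_intros prod_le_1 simp: abs_prod)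
    qed
    \<comment> \<open>Under the diagonal law all coordinates coincide, so the limit is the product
      test function evaluated on constant sequences.\<close>
    also have "(\<integral>y. (\<Prod>i<k. h i y) \<partial>mu0) = (\<integral>z. (\<Prod>i<k. h i (z i)) \<partial>distr mu0 borel (\<lambda>y i. y))"
      by (subst integral_distr[OF const prod_meas[of h, OF h(1)]]) simp
    finally show "(\<lambda>n. \<integral>z. (\<Prod>i<k. h i (z i)) \<partial>distr (P n) borel (\<lambda>\<omega> i. x n i \<omega>)) \<longlonglongrightarrow>
        (\<integral>z. (\<Prod>i<k. h i (z i)) \<partial>distr mu0 borel (\<lambda>y i. y))"
      by (simp add: law_x[of h, OF h])
  qed (auto intro: prob_x)
  show ?thesis using A1 A2 B1 B2 by blast
qed

end
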